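(* Let $(X,f)$ be a (homeomorphic) essentially minimal zero-dimensional system. Then the topological rank of $(X,f)$ defined by essentially simple Bratteli--Vershik models and the topological rank of $(X,f)$ defined by KR-covering models coincide.
   Context: Systems. A (homeomorphic) zero-dimensional system is a pair $(X,f)$ with $X$ a compact totally disconnected metric space and $f:X\to X$ a homeomorphism; it is essentially minimal if it has a unique minimal set. Bratteli--Vershik models. A Bratteli diagram is an infinite directed graph $(V,E)$ with $V=V_0\sqcup V_1\sqcup\cdots$, $E=E_1\sqcup E_2\sqcup\cdots$ (all parts finite and non-empty), $V_0=\{v_0\}$, source and range maps $s:E_n\to V_{n-1}$, $r:E_n\to V_n$ with $s^{-1}(v)\neq\emptyset$ for all $v\in V$ and $r^{-1}(v)\ne\emptyset$ for all $v\in V\setminus V_0$ (multiple edges allowed). Its rank is $\liminf_{n\to\infty}|V_n|$. It is ordered if each $r^{-1}(v)$, $v\in V\setminus V_0$, carries a linear order. It is essentially simple if there is a unique infinite path $p_{\max}$ from $V_0$ all of whose edges are maximal in their sets $r^{-1}(\cdot)$, and a unique infinite path $p_{\min}$ from $V_0$ all of whose edges are minimal. Let $E_{0,\infty}=\{(e_1,e_2,\dots):e_i\in E_i,\ r(e_i)=s(e_{i+1})\}$ with the product topology. The Vershik map $\phi:E_{0,\infty}\to E_{0,\infty}$ sends $p_{\max}$ to $p_{\min}$, and for $e\ne p_{\max}$, with $n$ least such that $e_n$ is not maximal, $f_n$ the successor of $e_n$ in $r^{-1}(r(e_n))$ and $(f_1,\dots,f_{n-1})$ the path of minimal edges from $v_0$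 to $s(f_n)$, $\phi(e)=(f_1,\dots,f_n,e_{n+1},e_{n+2},\dots)$. The topological rank of $(X,f)$ by essentially simple Bratteli--Vershik models is the minimum $K\in\{1,2,\dots,\infty\}$ of the ranks of essentially simple ordered Bratteli diagrams whose Vershik system $(E_{0,\infty},\phi)$ is topologically conjugate to $(X,f)$. KR-covering models. A finite directed graph $G=(V(G),E(G))$ has $E(G)\subseteq V(G)\times V(G)$, and every vertex is assumed to have an incoming and an outgoing edge. A graph homomorphism $\varphi:G_1\to G_2$ is edge-surjective if $\varphi(E(G_1))=E(G_2)$, and $+$directional if $(u,v),(u,v')\in E(G_1)$ implies $\varphi(v)=\varphi(v')$. A cover is a $+$directional edge-surjective homomorphism. A covering is a sequence of covers $G_0\xleftarrow{\varphi_1}G_1\xleftarrow{\varphi_2}\cdots$ with $G_0$ the graph with one vertex and one loop. Its inverse limit is $(X,f)$ with $X=\{(v_0,v_1,\dots)\in\prod_nV(G_n): v_n=\varphi_{n+1}(v_{n+1})\}$ and $f(x)=y$ iff $(u_n,v_n)\in E(G_n)$ for all $n$, where $x=(u_n)_n$, $y=(v_n)_n$. A circuit of length $l\ge1$ is a closed walk $(v_0,\dots,v_l=v_0)$ with $v_0,\dots,v_{l-1}$ distinct. A generalized figure 8 is a graph $G$ with a center $v_0$ and distinct circuits $c_1,\dots,c_r$ starting at $v_0$, pairwise meeting only in $v_0$, whose edges exhaust $E(G)$; $r$ is its rank. A KR-covering is a covering in which each $G_n$ is a generalized figure 8 with center $v_{n,0}$ and $\varphi_{n+1}(v_{n+1,0})=v_{n,0}$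 for all $n\ge0$; its rank is $\liminf_{n\to\infty}r_n$, where $r_n$ is the rank of $G_n$. The topological rank of $(X,f)$ by KR-covering models is the minimum $K\in\{1,2,\dots,\infty\}$ of the ranks of KR-coverings whose inverse limit is topologically conjugate to $(X,f)$. *)

theory Defs
  imports "HOL-Analysis.Analysis" "Graph_Theory.Graph_Theory"
begin

section \<open>Zero-dimensional systems\<close>

definition totally_disconnected_space :: "'a topology \<Rightarrow> bool" where
  "totally_disconnected_space X \<longleftrightarrow> (\<forall>S. connectedin X S \<longrightarrow> (\<exists>a. S \<subseteq> {a}))"

definition zero_dim_system :: "'a topology \<Rightarrow> ('a \<Rightarrow> 'a) \<Rightarrow> bool" where
  "zero_dim_system X f \<longleftrightarrow>
     compact_space X \<and> metrizable_space X \<and> totally_disconnected_space X \<and>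
     homeomorphic_map X X f"

definition closed_invariant :: "'a topology \<Rightarrow> ('a \<Rightarrow> 'a) \<Rightarrow> 'a set \<Rightarrow> bool" where
  "closed_invariant X f M \<longleftrightarrow> closedin X M \<and> M \<noteq> {} \<and> f ` M = M"

definition minimal_set :: "'a topology \<Rightarrow> ('a \<Rightarrow> 'a) \<Rightarrow> 'a set \<Rightarrow> bool" where
  "minimal_set X f M \<longleftrightarrow>
     closed_invariant X f M \<and> (\<forall>N. closed_invariant X f N \<and> N \<subseteq> M \<longrightarrow> N = M)"

definition essentially_minimal :: "'a topology \<Rightarrow> ('a \<Rightarrow> 'a) \<Rightarrow> bool" where
  "essentially_minimal X f \<longleftrightarrow> (\<exists>!M. minimal_set X f M)"

definition top_conjugate ::
  "'a topology \<Rightarrow> ('a \<Rightarrow> 'a) \<Rightarrow> 'b topology \<Rightarrow> ('b \<Rightarrow> 'b) \<Rightarrow> bool" where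
  "top_conjugate X f Y g \<longleftrightarrow>
     (\<exists>h. homeomorphic_map X Y h \<and> (\<forall>x\<in>topspace X. h (f x) = g (h x)))"


section \<open>Ordered Bratteli diagrams and Vershik maps\<close>

text \<open>
  Levels are kept apart by the index, so the vertex sets (and the edge sets) of different
  levels may share labels. Edges are indexed from 0: \<open>bE B n\<close> is the set $E_{n+1}$ of edges
  from level \<open>n\<close> to level \<open>n + 1\<close>. The relation \<open>bord B n v\<close> is the (reflexive) linear order
  on the edges of \<open>bE B n\<close> that end in \<open>v\<close>.
\<close>

record ('v, 'e) bratteli =
  bV :: "nat \<Rightarrow> 'v set"
  bE :: "nat \<Rightarrow> 'e set"
  bsrc :: "nat \<Rightarrow> 'e \<Rightarrow> 'v"
  brng :: "nat \<Rightarrow> 'e \<Rightarrow> 'v"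

record ('v, 'e) ordered_bratteli = "('v, 'e) bratteli" +
  bord :: "nat \<Rightarrow> 'v \<Rightarrow> 'e rel"

definition in_edges :: "('v, 'e, 'm) bratteli_scheme \<Rightarrow> nat \<Rightarrow> 'v \<Rightarrow> 'e set" where
  "in_edges B n v = {e \<in> bE B n. brng B n e = v}"

definition bratteli_diagram :: "('v, 'e, 'm) bratteli_scheme \<Rightarrow> bool" where
  "bratteli_diagram B \<longleftrightarrow>
     (\<exists>v. bV B 0 = {v}) \<and>
     (\<forall>n. finite (bV B n) \<and> bV B n \<noteq> {}) \<and>
     (\<forall>n. finite (bE B n) \<and> bE B n \<noteq> {}) \<and>
     (\<forall>n. \<forall>e\<in>bE B n. bsrc B n e \<in> bV B n \<and> brng B n e \<in> bV B (Suc n)) \<and>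
     (\<forall>n. \<forall>v\<in>bV B n. \<exists>e\<in>bE B n. bsrc B n e = v) \<and>
     (\<forall>n. \<forall>v\<in>bV B (Suc n). in_edges B n v \<noteq> {})"

definition bratteli_rank :: "('v, 'e, 'm) bratteli_scheme \<Rightarrow> enat" where
  "bratteli_rank B = liminf (\<lambda>n. enat (card (bV B n)))"

definition ordered_bratteli_diagram :: "('v, 'e) ordered_bratteli \<Rightarrow> bool" where
  "ordered_bratteli_diagram B \<longleftrightarrow>
     bratteli_diagram B \<and>
     (\<forall>n. \<forall>v\<in>bV B (Suc n). linear_order_on (in_edges B n v) (bord B n v))"

definition bpaths :: "('v, 'e, 'm) bratteli_scheme \<Rightarrow> (nat \<Rightarrow> 'e) set" where
  "bpaths B = {p. \<forall>n. p n \<in> bE B n \<and> brng B n (p n) = bsrc B (Suc n) (p (Suc n))}"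

definition bpath_topology :: "('v, 'e, 'm) bratteli_scheme \<Rightarrow> (nat \<Rightarrow> 'e) topology" where
  "bpath_topology B =
     subtopology (product_topology (\<lambda>n. discrete_topology (bE B n)) UNIV) (bpaths B)"

definition max_edge :: "('v, 'e) ordered_bratteli \<Rightarrow> nat \<Rightarrow> 'e \<Rightarrow> bool" where
  "max_edge B n e \<longleftrightarrow>
     e \<in> bE B n \<and> (\<forall>e' \<in> in_edges B n (brng B n e). (e', e) \<in> bord B n (brng B n e))"

definition min_edge :: "('v, 'e) ordered_bratteli \<Rightarrow> nat \<Rightarrow> 'e \<Rightarrow> bool" where
  "min_edge B n e \<longleftrightarrow>
     e \<in> bE B n \<and> (\<forall>e' \<in> in_edges B n (brng B n e). (e, e') \<in> bord B n (brng B n e))"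

definition succ_edge :: "('v, 'e) ordered_bratteli \<Rightarrow> nat \<Rightarrow> 'e \<Rightarrow> 'e \<Rightarrow> bool" where
  "succ_edge B n e e' \<longleftrightarrow>
     (let v = brng B n e; above = (\<lambda>d. d \<in> in_edges B n v \<and> (e, d) \<in> bord B n v \<and> d \<noteq> e)
      in above e' \<and> (\<forall>d. above d \<longrightarrow> (e', d) \<in> bord B n v))"

definition max_path :: "('v, 'e) ordered_bratteli \<Rightarrow> (nat \<Rightarrow> 'e) \<Rightarrow> bool" where
  "max_path B p \<longleftrightarrow> p \<in> bpaths B \<and> (\<forall>n. max_edge B n (p n))"

definition min_path :: "('v, 'e) ordered_bratteli \<Rightarrow> (nat \<Rightarrow> 'e) \<Rightarrow> bool" where
  "min_path B p \<longleftrightarrow> p \<in> bpaths B \<and> (\<forall>n. min_edge B n (p n))"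

definition essentially_simple :: "('v, 'e) ordered_bratteli \<Rightarrow> bool" where
  "essentially_simple B \<longleftrightarrow> (\<exists>!p. max_path B p) \<and> (\<exists>!p. min_path B p)"

definition vershik_map :: "('v, 'e) ordered_bratteli \<Rightarrow> (nat \<Rightarrow> 'e) \<Rightarrow> nat \<Rightarrow> 'e" where
  "vershik_map B p =
     (if max_path B p then (THE q. min_path B q)
      else let n = (LEAST n. \<not> max_edge B n (p n)) in
        (THE q. q \<in> bpaths B \<and> (\<forall>i<n. min_edge B i (q i)) \<and>
                succ_edge B n (p n) (q n) \<and> (\<forall>i>n. q i = p i)))"

text \<open>
  Diagrams are labelled by natural numbers; since all levels are finite, every ordered
  Bratteli diagram is isomorphic to one of these. On \<^typ>\<open>enat\<close>, the infimum of a non-empty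
  set is its minimum (and the infimum of the empty set is \<open>\<infinity>\<close>).
\<close>

definition top_rank_BV :: "'a topology \<Rightarrow> ('a \<Rightarrow> 'a) \<Rightarrow> enat" where
  "top_rank_BV X f =
     Inf {bratteli_rank B | B :: (nat, nat) ordered_bratteli.
            ordered_bratteli_diagram B \<and> essentially_simple B \<and>
            top_conjugate X f (bpath_topology B) (vershik_map B)}"


section \<open>KR-coverings\<close>

definition fin_graph :: "'v pair_pre_digraph \<Rightarrow> bool" where
  "fin_graph G \<longleftrightarrow>
     pair_fin_digraph G \<and>
     (\<forall>v\<in>pverts G. (\<exists>u. (u, v) \<in> parcs G) \<and> (\<exists>w. (v, w) \<in> parcs G))"

definition graph_hom :: "'v pair_pre_digraph \<Rightarrow> 'w pair_pre_digraph \<Rightarrow> ('v \<Rightarrow> 'w) \<Rightarrow> bool" where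
  "graph_hom G H \<phi> \<longleftrightarrow>
     \<phi> ` pverts G \<subseteq> pverts H \<and> (\<forall>u v. (u, v) \<in> parcs G \<longrightarrow> (\<phi> u, \<phi> v) \<in> parcs H)"

definition edge_surjective ::
  "'v pair_pre_digraph \<Rightarrow> 'w pair_pre_digraph \<Rightarrow> ('v \<Rightarrow> 'w) \<Rightarrow> bool" where
  "edge_surjective G H \<phi> \<longleftrightarrow> map_prod \<phi> \<phi> ` parcs G = parcs H"

definition plus_directional :: "'v pair_pre_digraph \<Rightarrow> ('v \<Rightarrow> 'w) \<Rightarrow> bool" where
  "plus_directional G \<phi> \<longleftrightarrow>
     (\<forall>u v v'. (u, v) \<in> parcs G \<and> (u, v') \<in> parcs G \<longrightarrow> \<phi> v = \<phi> v')"

definition graph_cover :: "'v pair_pre_digraph \<Rightarrow> 'w pair_pre_digraph \<Rightarrow> ('v \<Rightarrow> 'w) \<Rightarrow> bool" where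
  "graph_cover G H \<phi> \<longleftrightarrow> graph_hom G H \<phi> \<and> edge_surjective G H \<phi> \<and> plus_directional G \<phi>"

text \<open>The map \<open>\<phi> (Suc n)\<close> goes from \<open>G (Suc n)\<close> to \<open>G n\<close>; the value \<open>\<phi> 0\<close> is not used.\<close>

definition graph_covering :: "(nat \<Rightarrow> 'v pair_pre_digraph) \<Rightarrow> (nat \<Rightarrow> 'v \<Rightarrow> 'v) \<Rightarrow> bool" where
  "graph_covering G \<phi> \<longleftrightarrow>
     (\<exists>v. pverts (G 0) = {v} \<and> parcs (G 0) = {(v, v)}) \<and>
     (\<forall>n. fin_graph (G n)) \<and>
     (\<forall>n. graph_cover (G (Suc n)) (G n) (\<phi> (Suc n)))"

definition invlim_topology ::
  "(nat \<Rightarrow> 'v pair_pre_digraph) \<Rightarrow> (nat \<Rightarrow> 'v \<Rightarrow> 'v) \<Rightarrow> (nat \<Rightarrow> 'v) topology" where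
  "invlim_topology G \<phi> =
     subtopology (product_topology (\<lambda>n. discrete_topology (pverts (G n))) UNIV)
       {x. \<forall>n. x n = \<phi> (Suc n) (x (Suc n))}"

text \<open>For a covering, the \<open>y\<close> below exists and is unique, as the covers are +directional.\<close>

definition invlim_map ::
  "(nat \<Rightarrow> 'v pair_pre_digraph) \<Rightarrow> (nat \<Rightarrow> 'v \<Rightarrow> 'v) \<Rightarrow> (nat \<Rightarrow> 'v) \<Rightarrow> nat \<Rightarrow> 'v" where
  "invlim_map G \<phi> x =
     (THE y. y \<in> topspace (invlim_topology G \<phi>) \<and> (\<forall>n. (x n, y n) \<in> parcs (G n)))"

text \<open>A circuit $(v_0, \dots, v_l = v_0)$ is the list of all its \<open>l + 1\<close> vertices.\<close>

definition circuit :: "'v pair_pre_digraph \<Rightarrow> 'v list \<Rightarrow> bool" where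
  "circuit G c \<longleftrightarrow>
     vwalk c (with_proj G) \<and> vwalk_length c \<ge> 1 \<and> last c = hd c \<and> distinct (butlast c)"

definition generalized_figure_8 :: "'v pair_pre_digraph \<Rightarrow> 'v \<Rightarrow> nat \<Rightarrow> bool" where
  "generalized_figure_8 G v0 r \<longleftrightarrow>
     (\<exists>C. finite C \<and> card C = r \<and>
          (\<forall>c\<in>C. circuit G c \<and> hd c = v0) \<and>
          (\<forall>c\<in>C. \<forall>d\<in>C. c \<noteq> d \<longrightarrow> set c \<inter> set d = {v0}) \<and>
          parcs G = (\<Union>c\<in>C. set (vwalk_arcs c)))"

definition KR_covering ::
  "(nat \<Rightarrow> 'v pair_pre_digraph) \<Rightarrow> (nat \<Rightarrow> 'v \<Rightarrow> 'v) \<Rightarrow> (nat \<Rightarrow> 'v) \<Rightarrow> (nat \<Rightarrow> nat) \<Rightarrow> bool" where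
  "KR_covering G \<phi> v0 r \<longleftrightarrow>
     graph_covering G \<phi> \<and>
     (\<forall>n. v0 n \<in> pverts (G n) \<and> generalized_figure_8 (G n) (v0 n) (r n)) \<and>
     (\<forall>n. \<phi> (Suc n) (v0 (Suc n)) = v0 n)"

text \<open>As before, every covering is isomorphic to one by graphs on natural numbers.\<close>

definition top_rank_KR :: "'a topology \<Rightarrow> ('a \<Rightarrow> 'a) \<Rightarrow> enat" where
  "top_rank_KR X f =
     Inf {liminf (\<lambda>n. enat (r n)) | (G :: nat \<Rightarrow> nat pair_pre_digraph) \<phi> v0 r.
            KR_covering G \<phi> v0 r \<and>
            top_conjugate X f (invlim_topology G \<phi>) (invlim_map G \<phi>)}"

end

theory Submission
  imports Defs
begin

text \<open>
  Both kinds of model encode the same dynamical object: a sequence of partitions of the space into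
  finitely many towers. At level \<open>n\<close> every point \<open>x\<close> lies in a tower \<open>\<iota> n x\<close>
  at a floor \<open>\<tau> n x\<close>; the map moves \<open>x\<close> one floor up, and from the top floor of a tower
  to the bottom floor of some tower. The partitions refine each other, the union of the bottom
  floors (the base) shrinks to a single point, and the partitions separate points. The locale
  \<open>tower_system\<close> records this, and the theorem reduces to four passages that control the
  number of towers.

  From a KR-covering to towers (lemma \<open>tower_system\<close> in \<open>KR_covering_system\<close>): the towers are
  the circuits of \<open>G n\<close>. Locating the \<^emph>\<open>arc\<close> from the \<open>n\<close>-th coordinate of a point to that of
  its image, rather than the coordinate alone, tells in which circuit the point lies even if it sits
  at the center.

  From towers to a diagram (\<open>diagram_conjugate\<close>): the vertices of level \<open>n\<close> are the towers, and the
  edges into a tower of level \<open>n + 1\<close> are the floors of that tower that lie over the base of level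
  \<open>n\<close>, ordered by height. A point becomes the path of the floors at which its current visit to
  the towers of lower level began. Minimal paths are points in all bases, and maximal paths are
  points whose image lies in all bases; so bijectivity of the map and uniqueness of the base point
  give essential simplicity.

  From a diagram to towers (\<open>bratteli_tower_system\<close>): the tower of a path is the vertex that it
  reaches at level \<open>n\<close>, and the floor is the rank of its initial segment among all paths to that
  vertex in the lexicographic order in which the Vershik map moves.

  From towers to a KR-covering (\<open>graph_conjugate\<close>): the graph of level \<open>n\<close> is the image of the
  system under the partition into floors, where the bottom floors of all towers are glued to the
  center. The bonding maps are +directional as soon as the base of level \<open>n + 1\<close> lies in a
  single tower of level \<open>n\<close>. This need not hold at first, but by compactness it holds along a
  subsequence of levels (\<open>proper_subsequence\<close>), since the bases shrink to a point. If the rank is a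
  finite number \<open>K\<close>, the subsequence can be chosen among the levels with at most \<open>K\<close> towers, so the
  limit inferior does not increase. Distinct towers of height 1 give the same circuit, namely the
  loop at the center; this can only lower the number of circuits, and it does not affect the limit,
  because the point in all bases is unique.
\<close>

section \<open>Spaces of sequences over finite alphabets\<close>

text \<open>Both path spaces and inverse limits have this form.\<close>
definition seq_space :: "(nat \<Rightarrow> 'b set) \<Rightarrow> (nat \<Rightarrow> 'b) set \<Rightarrow> (nat \<Rightarrow> 'b) topology" where
  "seq_space D S = subtopology (product_topology (\<lambda>n. discrete_topology (D n)) UNIV) S"

lemma topspace_seq_space: "topspace (seq_space D S) = {s \<in> S. \<forall>n. s n \<in> D n}"
  by (auto simp: seq_space_def PiE_UNIV_domain)

text \<open>
  The space is given by an equation so that the lemma applies directly to path spaces and inverse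
  limits.
\<close>
lemma openin_seq_space_prefix:
  assumes Y: "Y = seq_space D S"
    and prefix: "\<And>s t. s \<in> topspace Y \<Longrightarrow> t \<in> topspace Y \<Longrightarrow> (\<forall>i<N. s i = t i) \<Longrightarrow> Q s \<Longrightarrow> Q t"
  shows "openin Y {s \<in> topspace Y. Q s}" (is "openin ?Y ?A")
proof (subst openin_subopen, rule ballI)
  fix s assume s: "s \<in> ?A"
  \<comment> \<open>the cylinder of all sequences that agree with \<open>s\<close> below \<open>N\<close>\<close>
  define U where "U = (\<Pi>\<^sub>E i\<in>UNIV. if i < N then {s i} else D i)"
  have "openin (product_topology (\<lambda>n. discrete_topology (D n)) UNIV) U"
    unfolding U_def openin_PiE_gen
  proof (intro disjI2 conjI ballI)
    show "finite {i \<in> UNIV. (if i < N then {s i} else D i) \<noteq> topspace (discrete_topology (D i))}"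
      by (rule finite_subset[of _ "{..<N}"]) auto
    show "openin (discrete_topology (D i)) (if i < N then {s i} else D i)" for i
      using s by (auto simp: Y topspace_seq_space)
  qed
  then have "openin ?Y (U \<inter> S)"
    unfolding Y seq_space_def by (rule openin_subtopology_Int)
  moreover have "s \<in> U \<inter> S"
    using s by (auto simp: Y U_def topspace_seq_space)
  moreover have "U \<inter> S \<subseteq> ?A"
  proof
    fix t assume t: "t \<in> U \<inter> S"
    have *: "(i < N \<longrightarrow> t i = s i) \<and> (\<not> i < N \<longrightarrow> t i \<in> D i)" for i
    proof -
      have "t i \<in> (if i < N then {s i} else D i)"
        using t unfolding U_def by (blast dest: PiE_mem)
      then show ?thesis by (cases "i < N") simp_all
    qed
    have "t i \<in> D i" for i
      using *[of i] s by (cases "i < N") (auto simp: Y topspace_seq_space)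
    then have "t \<in> topspace ?Y" using t by (auto simp: Y topspace_seq_space)
    then show "t \<in> ?A" using prefix[of s t] s * by auto
  qed
  ultimately show "\<exists>T. openin ?Y T \<and> s \<in> T \<and> T \<subseteq> ?A" by blast
qed

text \<open>
  A condition on consecutive entries fails on an open set of sequences, so it cuts a closed
  subset out of a compact product.
\<close>
lemma compact_seq_space:
  assumes "\<And>n. finite (D n)"
  shows "compact_space (seq_space D {s. \<forall>n. P n (s n) (s (Suc n))})"
proof -
  let ?P = "product_topology (\<lambda>n. discrete_topology (D n)) UNIV"
  let ?S = "{s. \<forall>n. P n (s n) (s (Suc n))}"
  have P: "?P = seq_space D UNIV" by (simp add: seq_space_def)
  have "compact_space ?P"
    using assms by (simp add: compact_space_product_topology compact_space_discrete_topology)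
  moreover have "closedin ?P (topspace ?P \<inter> ?S)"
  proof -
    have "openin ?P {s \<in> topspace ?P. \<not> P n (s n) (s (Suc n))}" for n
      by (rule openin_seq_space_prefix[OF P, where N = "Suc (Suc n)"]) auto
    then have "openin ?P (\<Union>n. {s \<in> topspace ?P. \<not> P n (s n) (s (Suc n))})"
      by blast
    moreover have "topspace ?P - (\<Union>n. {s \<in> topspace ?P. \<not> P n (s n) (s (Suc n))})
        = topspace ?P \<inter> ?S" by blast
    ultimately show ?thesis using closedin_diff[OF closedin_topspace, of ?P] by fastforce
  qed
  ultimately have "compactin ?P (topspace ?P \<inter> ?S)"
    using closedin_compact_space by blast
  then have "compact_space (subtopology ?P (topspace ?P \<inter> ?S))"
    by (rule compact_space_subtopology)
  then show ?thesis
    by (simp only: seq_space_def subtopology_restrict)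
qed

lemma Hausdorff_seq_space: "Hausdorff_space (seq_space D S)"
  unfolding seq_space_def
  by (intro Hausdorff_space_subtopology) (simp add: Hausdorff_space_product_topology)

lemma compact_nested_nonempty:
  assumes X: "compact_space X"
    and C: "\<And>n::nat. closedin X (C n)" "\<And>n. C n \<noteq> {}" "\<And>n. C (Suc n) \<subseteq> C n"
  shows "(\<Inter>n. C n) \<noteq> {}"
proof (rule compact_space_imp_nest[OF X C(1,2)])
  show "antimono C" using C(3) by (intro decseq_SucI) 
qed

text \<open>
  The criterion behind both conjugacies that start from a system of towers: it suffices to realise
  every finite prefix of an admissible sequence, because compactness then realises the sequence
  itself, and a continuous bijection from a compact space to a Hausdorff space is a homeomorphism.
\<close>
lemma homeomorphic_map_seq_space:
  fixes F :: "'a \<Rightarrow> nat \<Rightarrow> 'b"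
  assumes X: "compact_space X"
    and open_fibre: "\<And>n b. openin X {x \<in> topspace X. F x n = b}"
    and into: "\<And>x. x \<in> topspace X \<Longrightarrow> F x \<in> topspace (seq_space D S)"
    and inj: "inj_on F (topspace X)"
    and approx: "\<And>s n. s \<in> topspace (seq_space D S) \<Longrightarrow> \<exists>x\<in>topspace X. \<forall>m<n. F x m = s m"
  shows "homeomorphic_map X (seq_space D S) F"
proof (rule continuous_imp_homeomorphic_map[OF _ X Hausdorff_seq_space _ inj])
  show "continuous_map X (seq_space D S) F"
    unfolding seq_space_def continuous_map_in_subtopology continuous_map_componentwise_UNIV
  proof (intro conjI allI)
    show "continuous_map X (discrete_topology (D k)) (\<lambda>x. F x k)" for k
      unfolding continuous_map_def
    proof (intro conjI allI impI)
      show "(\<lambda>x. F x k) \<in> topspace X \<rightarrow> topspace (discrete_topology (D k))"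
        using into by (auto simp: topspace_seq_space)
      fix U
      have "{x \<in> topspace X. F x k \<in> U} = (\<Union>b\<in>U. {x \<in> topspace X. F x k = b})" by blast
      then show "openin X {x \<in> topspace X. F x k \<in> U}"
        using open_fibre by auto
    qed
    show "F \<in> topspace X \<rightarrow> S" using into by (auto simp: topspace_seq_space)
  qed
  show "F ` topspace X = topspace (seq_space D S)"
  proof
    show "F ` topspace X \<subseteq> topspace (seq_space D S)" using into by blast
    show "topspace (seq_space D S) \<subseteq> F ` topspace X"
    proof
      fix s assume s: "s \<in> topspace (seq_space D S)"
      define C where "C n = {x \<in> topspace X. \<forall>m<n. F x m = s m}" for n
      have closed_fibre: "closedin X {x \<in> topspace X. F x m = s m}" for m
      proof -
        have "topspace X - (\<Union>b\<in>-{s m}. {x \<in> topspace X. F x m = b})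
            = {x \<in> topspace X. F x m = s m}" by auto
        moreover have "openin X (\<Union>b\<in>-{s m}. {x \<in> topspace X. F x m = b})"
          using open_fibre by blast
        ultimately show ?thesis using closedin_diff[OF closedin_topspace, of X] by fastforce
      qed
      have "closedin X (C n)" for n
      proof (induction n)
        case 0
        show ?case by (simp add: C_def)
      next
        case (Suc n)
        have "C (Suc n) = C n \<inter> {x \<in> topspace X. F x n = s n}"
          by (auto simp: C_def less_Suc_eq)
        then show ?case using Suc closed_fibre by auto
      qed
      moreover have "C n \<noteq> {}" for n using approx[OF s, of n] by (auto simp: C_def)
      moreover have "C (Suc n) \<subseteq> C n" for n by (auto simp: C_def)
      ultimately have "(\<Inter>n. C n) \<noteq> {}" by (rule compact_nested_nonempty[OF X])
      then obtain x where "\<And>n. x \<in> C n" by blast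
      then have "x \<in> topspace X" "F x = s" by (auto simp: C_def fun_eq_iff)
      then show "s \<in> F ` topspace X" by blast
    qed
  qed
qed

section \<open>Conjugacy\<close>

lemma homeomorphic_map_bij: "homeomorphic_map X X f \<Longrightarrow> bij_betw f (topspace X) (topspace X)"
  by (simp add: bij_betw_def homeomorphic_imp_injective_map homeomorphic_imp_surjective_map)

lemma top_conjugate_trans:
  assumes "top_conjugate X f Y g" "top_conjugate Y g Z k"
  shows "top_conjugate X f Z k"
proof -
  obtain h where h: "homeomorphic_map X Y h" "\<And>x. x \<in> topspace X \<Longrightarrow> h (f x) = g (h x)"
    using assms(1) by (auto simp: top_conjugate_def)
  obtain l where l: "homeomorphic_map Y Z l" "\<And>y. y \<in> topspace Y \<Longrightarrow> l (g y) = k (l y)"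
    using assms(2) by (auto simp: top_conjugate_def)
  have "h x \<in> topspace Y" if "x \<in> topspace X" for x
    using h(1) that homeomorphic_imp_surjective_map by fastforce
  then have "\<forall>x\<in>topspace X. (l \<circ> h) (f x) = k ((l \<circ> h) x)"
    using h(2) l(2) by simp
  then show ?thesis
    unfolding top_conjugate_def using homeomorphic_map_compose[OF h(1) l(1)] by blast
qed

lemma top_conjugate_bij:
  assumes "bij_betw f (topspace X) (topspace X)" "top_conjugate X f Y g"
  shows "bij_betw g (topspace Y) (topspace Y)"
proof -
  obtain h where h: "homeomorphic_map X Y h" "\<And>x. x \<in> topspace X \<Longrightarrow> h (f x) = g (h x)"
    using assms(2) by (auto simp: top_conjugate_def)
  have b: "bij_betw h (topspace X) (topspace Y)"
    using h(1) by (simp add: bij_betw_def homeomorphic_imp_injective_map homeomorphic_imp_surjective_map)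
  have "bij_betw (h \<circ> f) (topspace X) (topspace Y)"
    using assms(1) b by (rule bij_betw_trans)
  then have "bij_betw (g \<circ> h) (topspace X) (topspace Y)"
    using h(2) by (subst bij_betw_cong[of _ _ "h \<circ> f"]) auto
  then show ?thesis using b by (metis bij_betw_comp_iff)
qed

section \<open>Paths and the Vershik map\<close>

lemma bpath_topology_eq: 
  "bpath_topology B = seq_space (bE B)
     {p. \<forall>n. p n \<in> bE B n \<and> brng B n (p n) = bsrc B (Suc n) (p (Suc n))}"
  by (simp add: bpath_topology_def seq_space_def bpaths_def)

lemma topspace_bpath_topology: "topspace (bpath_topology B) = bpaths B"
  by (auto simp: bpath_topology_eq topspace_seq_space bpaths_def)

lemma succ_edge_iff:
  "succ_edge B n e e' \<longleftrightarrow> e' \<in> in_edges B n (brng B n e) \<and> (e, e') \<in> bord B n (brng B n e) \<and> e' \<noteq> e \<and>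
     (\<forall>d\<in>in_edges B n (brng B n e). (e, d) \<in> bord B n (brng B n e) \<longrightarrow> d \<noteq> e \<longrightarrow>
        (e', d) \<in> bord B n (brng B n e))"
  by (auto simp: succ_edge_def Let_def)

locale ordered_diagram =
  fixes B :: "('v, 'e) ordered_bratteli"
  assumes diagram: "ordered_bratteli_diagram B"
begin

lemma finite_vertices: "finite (bV B n)"
  and finite_edges: "finite (bE B n)"
  using diagram by (auto simp: ordered_bratteli_diagram_def bratteli_diagram_def)

lemma edge_ends: "e \<in> bE B n \<Longrightarrow> bsrc B n e \<in> bV B n \<and> brng B n e \<in> bV B (Suc n)"
  using diagram by (auto simp: ordered_bratteli_diagram_def bratteli_diagram_def)

lemma in_edges_nonempty: "v \<in> bV B (Suc n) \<Longrightarrow> in_edges B n v \<noteq> {}"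
  using diagram by (auto simp: ordered_bratteli_diagram_def bratteli_diagram_def)

lemma finite_in_edges: "finite (in_edges B n v)"
  using finite_edges[of n] by (auto simp: in_edges_def)

lemma order: "v \<in> bV B (Suc n) \<Longrightarrow> linear_order_on (in_edges B n v) (bord B n v)"
  using diagram by (auto simp: ordered_bratteli_diagram_def)

lemma
  assumes "v \<in> bV B (Suc n)"
  shows order_refl: "e \<in> in_edges B n v \<Longrightarrow> (e, e) \<in> bord B n v"
    and order_antisym: "(d, e) \<in> bord B n v \<Longrightarrow> (e, d) \<in> bord B n v \<Longrightarrow> d = e"
    and order_trans: "(c, d) \<in> bord B n v \<Longrightarrow> (d, e) \<in> bord B n v \<Longrightarrow> (c, e) \<in> bord B n v"
    and order_total: "d \<in> in_edges B n v \<Longrightarrow> e \<in> in_edges B n v \<Longrightarrow>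
          (d, e) \<in> bord B n v \<or> (e, d) \<in> bord B n v"
proof -
  have r: "refl_on (in_edges B n v) (bord B n v)" "trans (bord B n v)" "antisym (bord B n v)"
    "total_on (in_edges B n v) (bord B n v)"
    using order[OF assms]
    by (auto simp: linear_order_on_def partial_order_on_def preorder_on_def)
  show "e \<in> in_edges B n v \<Longrightarrow> (e, e) \<in> bord B n v"
    using r(1) by (rule refl_onD)
  show "(d, e) \<in> bord B n v \<Longrightarrow> (e, d) \<in> bord B n v \<Longrightarrow> d = e"
    using r(3) by (rule antisymD)
  show "(c, d) \<in> bord B n v \<Longrightarrow> (d, e) \<in> bord B n v \<Longrightarrow> (c, e) \<in> bord B n v"
    using r(2) by (rule transD)
  show "d \<in> in_edges B n v \<Longrightarrow> e \<in> in_edges B n v \<Longrightarrow>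
      (d, e) \<in> bord B n v \<or> (e, d) \<in> bord B n v"
    using r(1,4) by (cases "d = e") (auto dest: refl_onD simp: total_on_def)
qed

lemma least_edge:
  assumes "v \<in> bV B (Suc n)" "A \<subseteq> in_edges B n v" "A \<noteq> {}"
  shows "\<exists>e\<in>A. \<forall>d\<in>A. (e, d) \<in> bord B n v"
proof -
  have "finite A" using assms(2) finite_in_edges finite_subset by blast
  then show ?thesis using assms(3,2)
  proof (induction A rule: finite_ne_induct)
    case (singleton x)
    then show ?case using order_refl[OF assms(1)] by auto
  next
    case (insert x F)
    then obtain e where e: "e \<in> F" "\<forall>d\<in>F. (e, d) \<in> bord B n v" by auto
    show ?case
    proof (cases "(x, e) \<in> bord B n v")
      case True
      then have "\<forall>d\<in>insert x F. (x, d) \<in> bord B n v"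
        using e insert.prems order_refl[OF assms(1)] order_trans[OF assms(1)] by blast
      then show ?thesis by blast
    next
      case False
      then have "(e, x) \<in> bord B n v"
        using order_total[OF assms(1)] e insert.prems by blast
      then show ?thesis using e by blast
    qed
  qed
qed

lemma min_edge_unique:
  assumes "min_edge B n d" "min_edge B n e" "brng B n d = brng B n e"
  shows "d = e"
  using assms edge_ends[of d n] order_antisym[of "brng B n e" n d e]
  by (auto simp: min_edge_def in_edges_def)

lemma succ_edge_exists:
  assumes "e \<in> bE B n" "\<not> max_edge B n e"
  shows "\<exists>e'. succ_edge B n e e'"
proof -
  let ?v = "brng B n e"
  let ?A = "{d \<in> in_edges B n ?v. (e, d) \<in> bord B n ?v \<and> d \<noteq> e}"
  have v: "?v \<in> bV B (Suc n)" using edge_ends assms(1) by blast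
  have e: "e \<in> in_edges B n ?v" using assms(1) by (simp add: in_edges_def)
  obtain d where "d \<in> in_edges B n ?v" "(d, e) \<notin> bord B n ?v"
    using assms by (auto simp: max_edge_def)
  then have "d \<in> ?A" using order_total[OF v e] order_refl[OF v e] by blast
  then have "\<exists>e'\<in>?A. \<forall>d\<in>?A. (e', d) \<in> bord B n ?v"
    by (intro least_edge[OF v]) auto
  then show ?thesis unfolding succ_edge_iff by blast
qed

lemma succ_edge_unique:
  assumes "e \<in> bE B n" "succ_edge B n e d" "succ_edge B n e d'"
  shows "d = d'"
  using assms edge_ends[of e n] order_antisym[of "brng B n e" n d d']
  unfolding succ_edge_iff by blast

text \<open>
  Going down from level \<open>n\<close>, the vertex determines the minimal edge into it, and that edge
  determines the vertex one level below.
\<close>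
lemma min_prefix_unique:
  assumes "p \<in> bpaths B" "q \<in> bpaths B" "bsrc B n (p n) = bsrc B n (q n)"
    and "\<forall>i<n. min_edge B i (p i)" "\<forall>i<n. min_edge B i (q i)"
  shows "\<forall>i<n. p i = q i"
  using assms(3-)
proof (induction n)
  case (Suc n)
  have "p n = q n"
    by (rule min_edge_unique[of n]) (use Suc.prems assms(1,2) in \<open>auto simp: bpaths_def\<close>)
  then show ?case using Suc by (auto simp: less_Suc_eq)
qed simp

lemma min_prefix_exists:
  "v \<in> bV B n \<Longrightarrow> \<exists>g. (\<forall>i<n. min_edge B i (g i)) \<and>
     (\<forall>i. Suc i < n \<longrightarrow> brng B i (g i) = bsrc B (Suc i) (g (Suc i))) \<and>
     (\<forall>i. Suc i = n \<longrightarrow> brng B i (g i) = v)"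
proof (induction n arbitrary: v)
  case (Suc n)
  obtain e where e: "e \<in> in_edges B n v" "\<forall>d\<in>in_edges B n v. (e, d) \<in> bord B n v"
    using least_edge[OF Suc.prems order.refl in_edges_nonempty[OF Suc.prems]] by blast
  then have "min_edge B n e" "brng B n e = v" "bsrc B n e \<in> bV B n"
    using edge_ends by (auto simp: min_edge_def in_edges_def)
  moreover obtain g where "\<forall>i<n. min_edge B i (g i)"
    "\<forall>i. Suc i < n \<longrightarrow> brng B i (g i) = bsrc B (Suc i) (g (Suc i))"
    "\<forall>i. Suc i = n \<longrightarrow> brng B i (g i) = bsrc B n e"
    using Suc.IH[OF \<open>bsrc B n e \<in> bV B n\<close>] by blast
  ultimately show ?case
    by (intro exI[of _ "g(n := e)"]) (auto simp: less_Suc_eq)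
qed simp

text \<open>
  The definite description in the Vershik map is handled here once and for all: the successor edge
  is unique, and it determines the minimal path below it.
\<close>
lemma vershik_map_eqI:
  assumes p: "p \<in> bpaths B" and m: "\<not> max_edge B m (p m)" "\<forall>i<m. max_edge B i (p i)"
    and q: "q \<in> bpaths B" "\<forall>i<m. min_edge B i (q i)" "succ_edge B m (p m) (q m)" "\<forall>i>m. q i = p i"
  shows "vershik_map B p = q"
proof -
  have least: "(LEAST n. \<not> max_edge B n (p n)) = m"
    using m by (intro Least_equality) (auto simp: not_less[symmetric])
  have "(THE q. q \<in> bpaths B \<and> (\<forall>i<m. min_edge B i (q i)) \<and>
          succ_edge B m (p m) (q m) \<and> (\<forall>i>m. q i = p i)) = q"
  proof (rule the_equality)
    fix q' assume q': "q' \<in> bpaths B \<and> (\<forall>i<m. min_edge B i (q' i)) \<and>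
          succ_edge B m (p m) (q' m) \<and> (\<forall>i>m. q' i = p i)"
    have "q' m = q m"
      using succ_edge_unique[of "p m" m] p q(3) q' by (auto simp: bpaths_def)
    then have "\<forall>i<m. q' i = q i"
      using min_prefix_unique[of q' q m] q q' by auto
    then show "q' = q" using \<open>q' m = q m\<close> q(4) q' 
      by (metis ext linorder_neqE_nat)
  qed (use q in auto)
  then show ?thesis
    using m(1) least by (auto simp: vershik_map_def max_path_def)
qed

lemma vershik_map_not_max:
  assumes p: "p \<in> bpaths B" and m: "\<not> max_edge B m (p m)" "\<forall>i<m. max_edge B i (p i)"
  shows "vershik_map B p \<in> bpaths B" "\<forall>i<m. min_edge B i (vershik_map B p i)"
    "succ_edge B m (p m) (vershik_map B p m)" "\<forall>i>m. vershik_map B p i = p i"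
proof -
  have pm: "p m \<in> bE B m" using p by (auto simp: bpaths_def)
  obtain e where e: "succ_edge B m (p m) e" using succ_edge_exists[OF pm m(1)] by blast
  then have ein: "e \<in> bE B m" "brng B m e = brng B m (p m)"
    by (auto simp: succ_edge_iff in_edges_def)
  obtain g where g: "\<forall>i<m. min_edge B i (g i)"
    "\<forall>i. Suc i < m \<longrightarrow> brng B i (g i) = bsrc B (Suc i) (g (Suc i))"
    "\<forall>i. Suc i = m \<longrightarrow> brng B i (g i) = bsrc B m e"
    using min_prefix_exists[of "bsrc B m e" m] edge_ends[OF ein(1)] by blast
  \<comment> \<open>minimal edges below the successor edge, and the edges of \<open>p\<close> above it\<close>
  define q where "q i = (if i < m then g i else if i = m then e else p i)" for i
  have qE: "q i \<in> bE B i" for i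
    using g(1) ein p by (auto simp: q_def min_edge_def bpaths_def)
  have "brng B i (q i) = bsrc B (Suc i) (q (Suc i))" for i
  proof -
    consider "Suc i < m" | "Suc i = m" | "i = m" | "i > m" by linarith
    then show ?thesis
    proof cases
      case 3
      then show ?thesis using ein p by (auto simp: q_def bpaths_def)
    qed (use g ein p in \<open>auto simp: q_def bpaths_def\<close>)
  qed
  then have q: "q \<in> bpaths B" using qE by (auto simp: bpaths_def)
  have "vershik_map B p = q"
    by (rule vershik_map_eqI[OF p m q]) (use g e in \<open>auto simp: q_def\<close>)
  then show "vershik_map B p \<in> bpaths B" "\<forall>i<m. min_edge B i (vershik_map B p i)"
    "succ_edge B m (p m) (vershik_map B p m)" "\<forall>i>m. vershik_map B p i = p i"
    using q g e by (auto simp: q_def)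
qed

end

section \<open>Sequences of tower partitions\<close>

text \<open>
  \<open>H n i\<close> is the height of tower \<open>i\<close> of level \<open>n\<close>. At level 0 the whole space is one tower of one
  floor. The assumption \<open>base_point\<close> says that the bases shrink to at most one point; existence
  follows from compactness.
\<close>
locale tower_system =
  fixes X :: "'a topology" and f :: "'a \<Rightarrow> 'a"
    and \<iota> \<tau> :: "nat \<Rightarrow> 'a \<Rightarrow> nat" and H :: "nat \<Rightarrow> nat \<Rightarrow> nat"
  assumes compact: "compact_space X"
    and nonempty: "topspace X \<noteq> {}"
    and bij: "bij_betw f (topspace X) (topspace X)"
    and finite_towers: "finite (\<iota> n ` topspace X)"
    and open_cell: "openin X {x \<in> topspace X. \<iota> n x = i \<and> \<tau> n x = k}"
    and below: "x \<in> topspace X \<Longrightarrow> \<tau> n x < H n (\<iota> n x)"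
    and climb: "x \<in> topspace X \<Longrightarrow> Suc (\<tau> n x) < H n (\<iota> n x) \<Longrightarrow>
                  \<iota> n (f x) = \<iota> n x \<and> \<tau> n (f x) = Suc (\<tau> n x)"
    and return: "x \<in> topspace X \<Longrightarrow> Suc (\<tau> n x) = H n (\<iota> n x) \<Longrightarrow> \<tau> n (f x) = 0"
    and refine: "x \<in> topspace X \<Longrightarrow> y \<in> topspace X \<Longrightarrow>
                  \<iota> (Suc n) x = \<iota> (Suc n) y \<Longrightarrow> \<tau> (Suc n) x = \<tau> (Suc n) y \<Longrightarrow>
                  \<iota> n x = \<iota> n y \<and> \<tau> n x = \<tau> n y"
    and base_Suc: "x \<in> topspace X \<Longrightarrow> \<tau> (Suc n) x = 0 \<Longrightarrow> \<tau> n x = 0"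
    and root: "x \<in> topspace X \<Longrightarrow> y \<in> topspace X \<Longrightarrow> \<iota> 0 x = \<iota> 0 y"
    and root_base: "x \<in> topspace X \<Longrightarrow> \<tau> 0 x = 0"
    and separate: "x \<in> topspace X \<Longrightarrow> y \<in> topspace X \<Longrightarrow>
                  (\<And>n. \<iota> n x = \<iota> n y \<and> \<tau> n x = \<tau> n y) \<Longrightarrow> x = y"
    and base_point: "x \<in> topspace X \<Longrightarrow> y \<in> topspace X \<Longrightarrow>
                  (\<And>n. \<tau> n x = 0) \<Longrightarrow> (\<And>n. \<tau> n y = 0) \<Longrightarrow> x = y"
begin

lemma f_in: "x \<in> topspace X \<Longrightarrow> f x \<in> topspace X"
  using bij by (auto simp: bij_betw_def)

lemma f_inj: "x \<in> topspace X \<Longrightarrow> y \<in> topspace X \<Longrightarrow> f x = f y \<Longrightarrow> x = y"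
  using bij by (auto simp: bij_betw_def inj_on_def)

lemma f_surj: "y \<in> topspace X \<Longrightarrow> \<exists>x\<in>topspace X. f x = y"
  using bij unfolding bij_betw_def by (metis imageE)

lemma refine_le:
  assumes "x \<in> topspace X" "y \<in> topspace X" "m \<le> n"
    and "\<iota> n x = \<iota> n y" "\<tau> n x = \<tau> n y"
  shows "\<iota> m x = \<iota> m y" "\<tau> m x = \<tau> m y"
  using assms(3-5) by (induction n) (auto simp: le_Suc_eq dest: refine[OF assms(1,2)])

lemma base_le:
  assumes "x \<in> topspace X" "m \<le> n" "\<tau> n x = 0"
  shows "\<tau> m x = 0"
  using assms(2,3) by (induction n) (auto simp: le_Suc_eq dest: base_Suc[OF assms(1)])

lemma base_iff_top:
  assumes "x \<in> topspace X"
  shows "\<tau> n (f x) = 0 \<longleftrightarrow> Suc (\<tau> n x) = H n (\<iota> n x)"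
  using below[OF assms, of n] climb[OF assms, of n] return[OF assms, of n]
  by (metis Suc_lessI nat.simps(3))

lemma climb':
  assumes "x \<in> topspace X" "\<tau> n (f x) \<noteq> 0"
  shows "\<iota> n (f x) = \<iota> n x" "\<tau> n (f x) = Suc (\<tau> n x)"
  using below[OF assms(1), of n] climb[OF assms(1), of n] return[OF assms(1), of n] assms(2)
  by (metis Suc_lessI)+

text \<open>
  While a point climbs a tower of level \<open>n\<close> it avoids the base of level \<open>n\<close>, hence the smaller bases of
  all levels \<open>m \<ge> n\<close>; so it climbs by the same amount in its tower of level \<open>m\<close>.
\<close>
lemma ascend:
  assumes "z \<in> topspace X" "\<tau> n z + t < H n (\<iota> n z)" "n \<le> m"
  shows "(f ^^ t) z \<in> topspace X \<and> \<iota> m ((f ^^ t) z) = \<iota> m z \<and> \<tau> m ((f ^^ t) z) = \<tau> m z + t"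
  using assms(2,3)
proof (induction t arbitrary: m)
  case (Suc t)
  let ?y = "(f ^^ t) z"
  have y: "?y \<in> topspace X" "\<iota> n ?y = \<iota> n z" "\<tau> n ?y = \<tau> n z + t"
    "\<iota> m ?y = \<iota> m z" "\<tau> m ?y = \<tau> m z + t"
    using Suc.IH[of n] Suc.IH[of m] Suc.prems by auto
  have "\<tau> n (f ?y) \<noteq> 0" using climb[OF y(1), of n] y Suc.prems by auto
  then have "\<tau> m (f ?y) \<noteq> 0" using base_le[OF f_in[OF y(1)] Suc.prems(2)] by auto
  then show ?case using climb'[OF y(1), of m] y f_in by auto
qed (use assms(1) in auto)

text \<open>
  The converse motion: \<open>z\<close> is the point of the orbit of \<open>x\<close> in the bottom floor of the tower of
  level \<open>n\<close> in which \<open>x\<close> lies.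
\<close>
lemma descend:
  assumes "x \<in> topspace X"
  obtains z where "z \<in> topspace X" "\<tau> n z = 0" "(f ^^ \<tau> n x) z = x"
    "\<And>m. n \<le> m \<Longrightarrow> \<iota> m z = \<iota> m x \<and> \<tau> m z + \<tau> n x = \<tau> m x"
proof -
  have "\<exists>z\<in>topspace X. \<tau> n z = 0 \<and> (f ^^ k) z = x \<and>
      (\<forall>m\<ge>n. \<iota> m z = \<iota> m x \<and> \<tau> m z + k = \<tau> m x)" if "\<tau> n x = k" for k
    using assms that
  proof (induction k arbitrary: x)
    case (Suc k)
    obtain y where y: "y \<in> topspace X" "f y = x" using f_surj Suc.prems by blast
    have *: "\<iota> m y = \<iota> m x \<and> \<tau> m x = Suc (\<tau> m y)" if "n \<le> m" for m
    proof -
      have "\<tau> m (f y) \<noteq> 0" using base_le[OF f_in[OF y(1)] that] y Suc.prems by auto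
      then show ?thesis using climb'[OF y(1), of m] y by auto
    qed
    then have "\<tau> n y = k" using Suc.prems by auto
    from Suc.IH[OF y(1) this] obtain z where "z \<in> topspace X" "\<tau> n z = 0" "(f ^^ k) z = y"
      "\<forall>m\<ge>n. \<iota> m z = \<iota> m y \<and> \<tau> m z + k = \<tau> m y" by blast
    then show ?case using * y by (intro bexI[of _ z]) auto
  qed auto
  then show thesis using that by blast
qed

lemma position_mono: 
  assumes "x \<in> topspace X"
  shows "\<tau> n x \<le> \<tau> (Suc n) x"
  by (rule descend[OF assms, of n]) (metis le_SucI le_add2 order_refl)

lemma base_point_exists: "\<exists>x\<in>topspace X. \<forall>n. \<tau> n x = 0"
proof -
  let ?C = "\<lambda>n. {x \<in> topspace X. \<tau> n x = 0}"
  have "(\<Inter>n. ?C n) \<noteq> {}"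
  proof (rule compact_nested_nonempty[OF compact])
    fix n
    have "openin X (\<Union>(i, k)\<in>{(i, k). k \<noteq> 0}. {x \<in> topspace X. \<iota> n x = i \<and> \<tau> n x = k})"
      by (intro openin_Union) (auto simp: open_cell)
    moreover have "topspace X - (\<Union>(i, k)\<in>{(i, k). k \<noteq> 0}. {x \<in> topspace X. \<iota> n x = i \<and> \<tau> n x = k})
       = ?C n" by auto
    ultimately show "closedin X (?C n)" using closedin_diff[OF closedin_topspace, of X] by fastforce
    obtain x where x: "x \<in> topspace X" using nonempty by blast
    show "?C n \<noteq> {}" by (rule descend[OF x, of n]) blast
    show "?C (Suc n) \<subseteq> ?C n" using base_Suc by auto
  qed
  then show ?thesis by auto
qed

end

context tower_system
begin

lemma subsequence:
  assumes s: "strict_mono s" "s 0 = 0"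
  shows "tower_system X f (\<lambda>n. \<iota> (s n)) (\<lambda>n. \<tau> (s n)) (\<lambda>n. H (s n))"
proof
  have le: "m \<le> s m" for m using s(1) by (rule strict_mono_imp_increasing)
  have Suc_le: "s n \<le> s (Suc n)" for n using s(1) by (simp add: strict_mono_less_eq)
  fix x y n
  show "\<iota> (s n) x = \<iota> (s n) y \<and> \<tau> (s n) x = \<tau> (s n) y"
    if "x \<in> topspace X" "y \<in> topspace X" "\<iota> (s (Suc n)) x = \<iota> (s (Suc n)) y"
      "\<tau> (s (Suc n)) x = \<tau> (s (Suc n)) y"
    using refine_le[OF that(1,2) Suc_le that(3,4)] by simp
  show "\<tau> (s n) x = 0" if "x \<in> topspace X" "\<tau> (s (Suc n)) x = 0"
    using base_le[OF that(1) Suc_le that(2)] .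
  show "x = y" if "x \<in> topspace X" "y \<in> topspace X"
    "\<And>n. \<iota> (s n) x = \<iota> (s n) y \<and> \<tau> (s n) x = \<tau> (s n) y"
    using separate[OF that(1,2)] refine_le[OF that(1,2) le] that(3) by blast
  show "x = y" if "x \<in> topspace X" "y \<in> topspace X" "\<And>n. \<tau> (s n) x = 0" "\<And>n. \<tau> (s n) y = 0"
    using base_point[OF that(1,2)] base_le[OF that(1) le that(3)] base_le[OF that(2) le that(4)] by blast
  show "\<iota> (s 0) x = \<iota> (s 0) y" if "x \<in> topspace X" "y \<in> topspace X"
    unfolding s(2) using that by (rule root)
  show "topspace X \<noteq> {}" by (rule nonempty)
qed (simp_all add: s(2) compact bij finite_towers open_cell below climb return root_base)

text \<open>
  The sets of points in the base of level \<open>m\<close> but outside the tower of level \<open>n\<close> that contains the base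
  point are closed, decrease with \<open>m\<close>, and have empty intersection; so one of them is empty.
\<close>
lemma eventually_proper:
  "\<exists>m\<ge>n. \<forall>x\<in>topspace X. \<forall>y\<in>topspace X. \<tau> m x = 0 \<longrightarrow> \<tau> m y = 0 \<longrightarrow> \<iota> n x = \<iota> n y"
proof -
  obtain b where b: "b \<in> topspace X" "\<And>n. \<tau> n b = 0" using base_point_exists by blast
  have "\<exists>m\<ge>n. \<forall>x\<in>topspace X. \<tau> m x = 0 \<longrightarrow> \<iota> n x = \<iota> n b"
  proof (rule ccontr)
    assume contr: "\<not> ?thesis"
    let ?C = "\<lambda>m. {x \<in> topspace X. \<tau> (n + m) x = 0 \<and> \<iota> n x \<noteq> \<iota> n b}"
    have "(\<Inter>m. ?C m) \<noteq> {}"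
    proof (rule compact_nested_nonempty[OF compact])
      fix m
      let ?O = "\<lambda>l i k. {x \<in> topspace X. \<iota> l x = i \<and> \<tau> l x = k}"
      have "openin X ((\<Union>(i, k)\<in>{(i, k). k \<noteq> 0}. ?O (n + m) i k) \<union> (\<Union>k. ?O n (\<iota> n b) k))"
        by (intro openin_Union openin_Un) (auto simp: open_cell)
      moreover have "topspace X - ((\<Union>(i, k)\<in>{(i, k). k \<noteq> 0}. ?O (n + m) i k) \<union> (\<Union>k. ?O n (\<iota> n b) k))
        = ?C m" by auto
      ultimately show "closedin X (?C m)"
        using closedin_diff[OF closedin_topspace, of X] by fastforce
      have "\<exists>x\<in>topspace X. \<tau> (n + m) x = 0 \<and> \<iota> n x \<noteq> \<iota> n b"
        using contr by (meson le_add1)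
      then show "?C m \<noteq> {}" by blast
      show "?C (Suc m) \<subseteq> ?C m" using base_Suc by auto
    qed
    then obtain x where x: "x \<in> topspace X" "\<And>m. \<tau> (n + m) x = 0" "\<iota> n x \<noteq> \<iota> n b" by blast
    then have "\<tau> m x = 0" for m using base_le[OF x(1), of m "n + m"] by simp
    then show False using base_point[OF x(1) b(1)] b x(3) by blast
  qed
  then show ?thesis by metis
qed

end

text \<open>
  The base of each level lies in a single tower of the level before. This is what makes the
  bonding maps of the associated graphs +directional.
\<close>
locale proper_tower_system = tower_system +
  assumes proper: "x \<in> topspace X \<Longrightarrow> y \<in> topspace X \<Longrightarrow> \<tau> (Suc n) x = 0 \<Longrightarrow> \<tau> (Suc n) y = 0 \<Longrightarrow>
     \<iota> n x = \<iota> n y"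

text \<open>
  Telescoping. The freely chosen property \<open>P\<close> of infinitely many levels serves to keep the number of
  towers small along the subsequence.
\<close>
lemma (in tower_system) proper_subsequence:
  assumes "\<And>m. \<exists>n>m. P n"
  obtains s where "strict_mono s" "s 0 = 0" "\<And>n. P (s (Suc n))"
    "proper_tower_system X f (\<lambda>n. \<iota> (s n)) (\<lambda>n. \<tau> (s n)) (\<lambda>n. H (s n))"
proof -
  define good where "good m m' \<longleftrightarrow> m < m' \<and> P m' \<and>
    (\<forall>x\<in>topspace X. \<forall>y\<in>topspace X. \<tau> m' x = 0 \<longrightarrow> \<tau> m' y = 0 \<longrightarrow> \<iota> m x = \<iota> m y)" for m m'
  have "\<exists>m'. good m m'" for m
  proof -
    obtain k where k: "k \<ge> m"
      "\<forall>x\<in>topspace X. \<forall>y\<in>topspace X. \<tau> k x = 0 \<longrightarrow> \<tau> k y = 0 \<longrightarrow> \<iota> m x = \<iota> m y"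
      using eventually_proper by blast
    obtain m' where m': "k < m'" "P m'" using assms by blast
    then have "\<tau> k x = 0" if "x \<in> topspace X" "\<tau> m' x = 0" for x
      using base_le[OF that(1) _ that(2)] by simp
    then have "\<forall>x\<in>topspace X. \<forall>y\<in>topspace X. \<tau> m' x = 0 \<longrightarrow> \<tau> m' y = 0 \<longrightarrow> \<iota> m x = \<iota> m y"
      using k(2) by blast
    moreover have "m < m'" using k(1) m'(1) by simp
    ultimately have "good m m'" using m'(2) unfolding good_def by blast
    then show ?thesis by blast
  qed
  then obtain next_level where "\<And>m. good m (next_level m)" by metis
  then have nl: "\<And>m. m < next_level m" "\<And>m. P (next_level m)"
    "\<And>m x y. x \<in> topspace X \<Longrightarrow> y \<in> topspace X \<Longrightarrow> \<tau> (next_level m) x = 0 \<Longrightarrow>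
       \<tau> (next_level m) y = 0 \<Longrightarrow> \<iota> m x = \<iota> m y" unfolding good_def by blast+
  define s where "s n = (next_level ^^ n) 0" for n
  have s: "strict_mono s" "s 0 = 0" "s (Suc n) = next_level (s n)" for n
    using nl(1) by (simp_all add: s_def strict_mono_Suc_iff)
  interpret S: tower_system X f "\<lambda>n. \<iota> (s n)" "\<lambda>n. \<tau> (s n)" "\<lambda>n. H (s n)"
    by (rule subsequence[OF s(1,2)])
  have "proper_tower_system X f (\<lambda>n. \<iota> (s n)) (\<lambda>n. \<tau> (s n)) (\<lambda>n. H (s n))"
    by unfold_locales (unfold s(3), rule nl(3))
  moreover have "P (s (Suc n))" for n unfolding s(3) by (rule nl(2))
  ultimately show thesis using that[OF s(1,2)] by blast
qed

section \<open>From towers to an ordered Bratteli diagram\<close>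

context tower_system
begin

definition cell :: "nat \<Rightarrow> 'a \<Rightarrow> nat" where
  "cell n x = prod_encode (\<iota> n x, \<tau> n x)"

lemma cell_eq_iff: "cell n x = cell n y \<longleftrightarrow> \<iota> n x = \<iota> n y \<and> \<tau> n x = \<tau> n y"
  by (simp add: cell_def prod_encode_eq)

definition base :: "nat \<Rightarrow> 'a set" where
  "base n = {x \<in> topspace X. \<tau> n x = 0}"

text \<open>
  An edge into a tower of level \<open>n + 1\<close> is a floor of that tower inside the base of level \<open>n\<close>, coded
  as the pair of the tower and the height of the floor. By refinement all points of
  the floor lie in the same tower of level \<open>n\<close>, so any of them determines the source.
\<close>
definition diagram :: "(nat, nat) ordered_bratteli" where
  "diagram = \<lparr>bV = \<lambda>n. \<iota> n ` topspace X,
     bE = \<lambda>n. cell (Suc n) ` base n,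
     bsrc = \<lambda>n e. \<iota> n (inv_into (base n) (cell (Suc n)) e),
     brng = \<lambda>n e. fst (prod_decode e),
     bord = \<lambda>n v. {(d, e). d \<in> cell (Suc n) ` base n \<and> e \<in> cell (Suc n) ` base n \<and>
        fst (prod_decode d) = v \<and> fst (prod_decode e) = v \<and>
        snd (prod_decode d) \<le> snd (prod_decode e)}\<rparr>"

text \<open>
  The floor of the tower of level \<open>n + 1\<close> at which the current climb of \<open>x\<close> through a tower of level
  \<open>n\<close> began.
\<close>
definition address :: "'a \<Rightarrow> nat \<Rightarrow> nat" where
  "address x n = prod_encode (\<iota> (Suc n) x, \<tau> (Suc n) x - \<tau> n x)"

lemma vertices: "bV diagram n = \<iota> n ` topspace X"
  and edges: "bE diagram n = cell (Suc n) ` base n"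
  and range_cell: "brng diagram n (cell m z) = \<iota> m z"
  and range_address: "brng diagram n (address x n) = \<iota> (Suc n) x"
  by (simp_all add: diagram_def cell_def address_def)

lemma source_cell:
  assumes "z \<in> base n"
  shows "bsrc diagram n (cell (Suc n) z) = \<iota> n z"
proof -
  let ?y = "inv_into (base n) (cell (Suc n)) (cell (Suc n) z)"
  have "?y \<in> base n" "cell (Suc n) ?y = cell (Suc n) z"
    using assms by (auto intro: inv_into_into f_inv_into_f)
  then show ?thesis
    using refine[of ?y z n] assms by (simp add: diagram_def cell_eq_iff base_def)
qed

lemma address_foot:
  assumes "x \<in> topspace X"
  obtains z where "z \<in> base n" "address x n = cell (Suc n) z" "(f ^^ \<tau> n x) z = x"
    "\<And>m. n \<le> m \<Longrightarrow> \<iota> m z = \<iota> m x \<and> \<tau> m z + \<tau> n x = \<tau> m x"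
proof (rule descend[OF assms, of n])
  fix z assume z: "z \<in> topspace X" "\<tau> n z = 0" "(f ^^ \<tau> n x) z = x"
    "\<And>m. n \<le> m \<Longrightarrow> \<iota> m z = \<iota> m x \<and> \<tau> m z + \<tau> n x = \<tau> m x"
  have "\<iota> (Suc n) z = \<iota> (Suc n) x" "\<tau> (Suc n) z + \<tau> n x = \<tau> (Suc n) x" using z(4)[of "Suc n"] by auto
  then have "address x n = cell (Suc n) z" by (auto simp: address_def cell_def prod_encode_eq)
  then show thesis using z(1,2) by (intro that[OF _ _ z(3,4)]) (simp_all add: base_def)
qed

lemma address_edge:
  assumes "x \<in> topspace X"
  shows "address x n \<in> bE diagram n" "bsrc diagram n (address x n) = \<iota> n x"
proof -
  obtain z where z: "z \<in> base n" "address x n = cell (Suc n) z" "\<iota> n z = \<iota> n x"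
    by (rule address_foot[OF assms, of n]) auto
  then show "address x n \<in> bE diagram n" "bsrc diagram n (address x n) = \<iota> n x"
    by (simp_all add: source_cell edges)
qed

lemma address_path: "x \<in> topspace X \<Longrightarrow> address x \<in> bpaths diagram"
  by (simp add: bpaths_def address_edge range_address)

lemma in_edges_diagram: "in_edges diagram n v = {cell (Suc n) z | z. z \<in> base n \<and> \<iota> (Suc n) z = v}"
  by (auto simp: in_edges_def edges range_cell)

lemma order_cell:
  assumes "z \<in> base n" "w \<in> base n"
  shows "(cell (Suc n) z, cell (Suc n) w) \<in> bord diagram n v \<longleftrightarrow>
     \<iota> (Suc n) z = v \<and> \<iota> (Suc n) w = v \<and> \<tau> (Suc n) z \<le> \<tau> (Suc n) w"
  using assms by (simp add: diagram_def) (simp add: cell_def)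

lemma order_subset: "bord diagram n v \<subseteq> in_edges diagram n v \<times> in_edges diagram n v"
  by (auto simp: diagram_def in_edges_def)

lemma diagram_ordered: "ordered_bratteli_diagram diagram"
  unfolding ordered_bratteli_diagram_def bratteli_diagram_def
proof (intro conjI allI ballI)
  obtain x where x: "x \<in> topspace X" using nonempty by blast
  then have "bV diagram 0 = {\<iota> 0 x}" unfolding vertices using root by blast
  then show "\<exists>v. bV diagram 0 = {v}" by blast
  fix n
  show "finite (bV diagram n)" using finite_towers by (simp add: vertices)
  show "bV diagram n \<noteq> {}" using nonempty by (simp add: vertices)
  have "bE diagram n \<subseteq> prod_encode ` (SIGMA i:\<iota> (Suc n) ` topspace X. {..<H (Suc n) i})"
    using below by (auto simp: edges cell_def base_def)
  then show "finite (bE diagram n)"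
    by (rule finite_subset) (use finite_towers in auto)
  show "bE diagram n \<noteq> {}" using address_edge(1)[OF x] by blast
  fix e assume "e \<in> bE diagram n"
  then show "bsrc diagram n e \<in> bV diagram n" "brng diagram n e \<in> bV diagram (Suc n)"
    by (auto simp: edges vertices source_cell range_cell base_def)
next
  fix n v assume "v \<in> bV diagram n"
  then obtain x where "x \<in> topspace X" "v = \<iota> n x" by (auto simp: vertices)
  then show "\<exists>e\<in>bE diagram n. bsrc diagram n e = v" using address_edge[of x n] by blast
next
  fix n v assume "v \<in> bV diagram (Suc n)"
  then obtain x where "x \<in> topspace X" "v = \<iota> (Suc n) x" by (auto simp: vertices)
  then show "in_edges diagram n v \<noteq> {}" 
    using address_edge[of x n] range_address[of n x] by (auto simp: in_edges_def)
next
  fix n v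
  show "linear_order_on (in_edges diagram n v) (bord diagram n v)"
    unfolding linear_order_on_def partial_order_on_def preorder_on_def
  proof (intro conjI)
    show "bord diagram n v \<subseteq> in_edges diagram n v \<times> in_edges diagram n v" by (rule order_subset)
    show "refl_on (in_edges diagram n v) (bord diagram n v)"
      by (auto simp: refl_on_def in_edges_diagram order_cell)
    show "trans (bord diagram n v)"
      by (rule transI) (auto simp: diagram_def)
    show "antisym (bord diagram n v)"
      by (rule antisymI) (auto simp: diagram_def cell_def prod_encode_eq)
    show "total_on (in_edges diagram n v) (bord diagram n v)"
      by (auto simp: total_on_def in_edges_diagram order_cell)
  qed
qed

text \<open>
  A tower of level \<open>n + 1\<close> returns to the base of level \<open>n\<close> only when the tower of level \<open>n\<close> being climbed
  is finished. So a later visit lies strictly above the present position of \<open>x\<close>, not only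
  above the floor at which the present climb began.
\<close>
lemma next_visit:
  assumes x: "x \<in> topspace X" and z: "z \<in> base n" "\<iota> (Suc n) z = \<iota> (Suc n) x"
    and later: "\<tau> (Suc n) x < \<tau> (Suc n) z + \<tau> n x"
  shows "\<tau> (Suc n) x < \<tau> (Suc n) z"
proof (rule ccontr)
  assume contr: "\<not> ?thesis"
  obtain y where y: "y \<in> base n" "\<And>m. n \<le> m \<Longrightarrow> \<iota> m y = \<iota> m x \<and> \<tau> m y + \<tau> n x = \<tau> m x"
    by (rule address_foot[OF x, of n]) blast
  \<comment> \<open>Climbing from the foot \<open>y\<close> of the present climb leads to the floor of \<open>z\<close> at level \<open>n + 1\<close>, but
    to a positive height at level \<open>n\<close>.\<close>
  define t where "t = \<tau> (Suc n) z - \<tau> (Suc n) y"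
  have t: "0 < t" "t \<le> \<tau> n x" "\<tau> (Suc n) y + t = \<tau> (Suc n) z"
    using contr y(2)[of "Suc n"] later by (auto simp: t_def)
  have "\<tau> n y + t < H n (\<iota> n y)" 
    using below[OF x, of n] y(1) y(2)[of n] t by (auto simp: base_def)
  then have w: "(f ^^ t) y \<in> topspace X" "\<tau> n ((f ^^ t) y) = t"
    "\<iota> (Suc n) ((f ^^ t) y) = \<iota> (Suc n) z" "\<tau> (Suc n) ((f ^^ t) y) = \<tau> (Suc n) z"
    using ascend[of y n t n] ascend[of y n t "Suc n"] y(1) y(2)[of "Suc n"] z t by (auto simp: base_def)
  then have "\<tau> n ((f ^^ t) y) = \<tau> n z" using refine[of "(f ^^ t) y" z n] z by (auto simp: base_def)
  then show False using w t z by (auto simp: base_def)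
qed

text \<open>
  A minimal edge at level \<open>n\<close> means that the bottom floor of the tower of level \<open>n + 1\<close> begins the
  current climb; if \<open>x\<close> is at the start of that climb, \<open>x\<close> lies in the bottom floor.
\<close>
lemma min_path_address:
  assumes x: "x \<in> topspace X"
  shows "(\<forall>i<n. min_edge diagram i (address x i)) \<longleftrightarrow> \<tau> n x = 0"
proof (induction n)
  case 0
  then show ?case using root_base x by simp
next
  case (Suc n)
  have "min_edge diagram n (address x n) \<longleftrightarrow> \<tau> (Suc n) x = 0" if \<tau>: "\<tau> n x = 0"
  proof -
    have xb: "x \<in> base n" using x \<tau> by (simp add: base_def)
    have a: "address x n = cell (Suc n) x" using \<tau> by (simp add: address_def cell_def)
    obtain z where z: "z \<in> topspace X" "\<tau> (Suc n) z = 0" "\<iota> (Suc n) z = \<iota> (Suc n) x"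
      by (rule descend[OF x, of "Suc n"]) auto
    then have zb: "z \<in> base n" using base_Suc by (simp add: base_def)
    show ?thesis
    proof
      assume "min_edge diagram n (address x n)"
      then have "(cell (Suc n) x, cell (Suc n) z) \<in> bord diagram n (\<iota> (Suc n) x)"
        using zb z(3) by (auto simp: a min_edge_def range_cell in_edges_diagram)
      then show "\<tau> (Suc n) x = 0" using z by (simp add: order_cell xb zb)
    next
      assume "\<tau> (Suc n) x = 0"
      then show "min_edge diagram n (address x n)"
        using xb by (auto simp: a min_edge_def range_cell in_edges_diagram order_cell edges)
    qed
  qed
  then show ?case using Suc base_Suc[OF x] by (auto simp: less_Suc_eq)
qed

text \<open>
  An edge is maximal if the base of level \<open>n\<close> is not visited again in the tower of level \<open>n + 1\<close>. So,
  provided that \<open>x\<close> is about to finish its tower of level \<open>n\<close>, it is about to finish its tower of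
  level \<open>n + 1\<close> as well.
\<close>
lemma max_path_address:
  assumes x: "x \<in> topspace X"
  shows "(\<forall>i<n. max_edge diagram i (address x i)) \<longleftrightarrow> \<tau> n (f x) = 0"
proof (induction n)
  case 0
  then show ?case using root_base f_in x by simp
next
  case (Suc n)
  have "max_edge diagram n (address x n) \<longleftrightarrow> \<tau> (Suc n) (f x) = 0" if \<tau>: "\<tau> n (f x) = 0"
  proof -
    obtain y where y: "y \<in> base n" "address x n = cell (Suc n) y" 
      "\<iota> (Suc n) y = \<iota> (Suc n) x" "\<tau> (Suc n) y + \<tau> n x = \<tau> (Suc n) x"
      by (rule address_foot[OF x, of n]) auto
    show ?thesis
    proof
      assume max: "max_edge diagram n (address x n)"
      show "\<tau> (Suc n) (f x) = 0"
      proof (rule ccontr)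
        assume "\<tau> (Suc n) (f x) \<noteq> 0"
        note c = climb'[OF x this]
        have fb: "f x \<in> base n" using f_in x \<tau> by (simp add: base_def)
        then have "(cell (Suc n) (f x), cell (Suc n) y) \<in> bord diagram n (\<iota> (Suc n) x)"
          using max c(1) y(2,3) by (auto simp: max_edge_def range_cell in_edges_diagram)
        then show False using c y by (simp add: order_cell[OF fb y(1)])
      qed
    next
      assume "\<tau> (Suc n) (f x) = 0"
      then have top: "Suc (\<tau> (Suc n) x) = H (Suc n) (\<iota> (Suc n) x)" using base_iff_top[OF x] by simp
      have "\<tau> (Suc n) z \<le> \<tau> (Suc n) y" if "z \<in> base n" "\<iota> (Suc n) z = \<iota> (Suc n) x" for z
      proof (rule ccontr)
        assume "\<not> ?thesis"
        then have "\<tau> (Suc n) x < \<tau> (Suc n) z"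
          using y(4) by (intro next_visit[OF x that]) simp
        moreover have "\<tau> (Suc n) z < H (Suc n) (\<iota> (Suc n) z)" 
          using below that(1) by (simp add: base_def)
        ultimately show False using top that(2) by simp
      qed
      then show "max_edge diagram n (address x n)"
        using y(1,3) by (auto simp: y(2) max_edge_def range_cell in_edges_diagram order_cell edges)
    qed
  qed
  then show ?case using Suc base_Suc[OF f_in[OF x]] by (auto simp: less_Suc_eq)
qed

lemma address_inj: "inj_on address (topspace X)"
proof (rule inj_onI)
  fix x y assume xy: "x \<in> topspace X" "y \<in> topspace X" "address x = address y"
  have "\<iota> n x = \<iota> n y \<and> \<tau> n x = \<tau> n y" for n
  proof (induction n)
    case 0
    show ?case using root[OF xy(1,2)] root_base xy(1,2) by simp
  next
    case (Suc n)
    have "address x n = address y n" using xy(3) by simp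
    then show ?case
      using Suc position_mono[OF xy(1), of n] position_mono[OF xy(2), of n]
      by (auto simp: address_def prod_encode_eq)
  qed
  then show "x = y" using separate xy(1,2) by blast
qed

text \<open>
  Towers of level \<open>n + 1\<close> are concatenations of towers of level \<open>n\<close>. If \<open>x\<close> realises the first \<open>n\<close> edges,
  climbing by \<open>\<tau> n x\<close> from the floor described by the next edge reaches a point in the same
  floor of level \<open>n\<close> as \<open>x\<close>, which therefore has the same first \<open>n\<close> edges.
\<close>
lemma address_approx:
  assumes p: "p \<in> bpaths diagram"
  shows "\<exists>x\<in>topspace X. (\<forall>m<n. address x m = p m) \<and> \<iota> n x = bsrc diagram n (p n)"
proof (induction n)
  case 0
  have "p 0 \<in> bE diagram 0" using p by (auto simp: bpaths_def)
  then obtain z where "z \<in> base 0" "p 0 = cell (Suc 0) z" by (auto simp: edges)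
  then show ?case using source_cell by (intro bexI[of _ z]) (auto simp: base_def)
next
  case (Suc n)
  then obtain x where x: "x \<in> topspace X" "\<forall>m<n. address x m = p m" "\<iota> n x = bsrc diagram n (p n)"
    by blast
  have "p n \<in> bE diagram n" using p by (auto simp: bpaths_def)
  then obtain z where z: "z \<in> base n" "p n = cell (Suc n) z" by (auto simp: edges)
  then have zx: "\<iota> n z = \<iota> n x" using x(3) source_cell by simp
  have z0: "z \<in> topspace X" "\<tau> n z = 0" using z(1) by (auto simp: base_def)
  let ?w = "(f ^^ \<tau> n x) z"
  have "\<tau> n z + \<tau> n x < H n (\<iota> n z)" using below[OF x(1)] zx z0 by simp
  note w = ascend[OF z0(1) this]
  have w0: "?w \<in> topspace X" "\<iota> n ?w = \<iota> n x" "\<tau> n ?w = \<tau> n x" using w[of n] zx z0 by auto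
  have "address ?w m = address x m" if "m < n" for m
    using refine_le[OF w0(1) x(1), of "Suc m" n] refine_le[OF w0(1) x(1), of m n] w0 that
    by (simp add: address_def)
  moreover have "address ?w n = p n"
    using w[of "Suc n"] w0 z(2) by (simp add: address_def cell_def)
  moreover have "\<iota> (Suc n) ?w = bsrc diagram (Suc n) (p (Suc n))"
  proof -
    have "brng diagram n (p n) = bsrc diagram (Suc n) (p (Suc n))" using p by (auto simp: bpaths_def)
    then show ?thesis using w[of "Suc n"] z(2) by (simp add: range_cell)
  qed
  ultimately show ?case using w0(1) x(2) by (intro bexI[of _ ?w]) (auto simp: less_Suc_eq)
qed

lemma homeomorphic_map_address: "homeomorphic_map X (bpath_topology diagram) address"
  unfolding bpath_topology_eq
proof (rule homeomorphic_map_seq_space[OF compact _ _ address_inj])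
  fix n b
  let ?P = "{(i, k, i', k'). prod_encode (i', k' - k) = b}"
  have "openin X (\<Union>(i, k, i', k')\<in>?P. {x \<in> topspace X. \<iota> n x = i \<and> \<tau> n x = k} \<inter>
      {x \<in> topspace X. \<iota> (Suc n) x = i' \<and> \<tau> (Suc n) x = k'})"
    by (intro openin_Union) (auto intro!: openin_Int open_cell)
  moreover have "(\<Union>(i, k, i', k')\<in>?P. {x \<in> topspace X. \<iota> n x = i \<and> \<tau> n x = k} \<inter>
      {x \<in> topspace X. \<iota> (Suc n) x = i' \<and> \<tau> (Suc n) x = k'}) = {x \<in> topspace X. address x n = b}"
    by (auto simp: address_def)
  ultimately show "openin X {x \<in> topspace X. address x n = b}" by simp
next
  fix x assume "x \<in> topspace X"
  then show "address x \<in> topspace (seq_space (bE diagram) {p. \<forall>n. p n \<in> bE diagram n \<and>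
      brng diagram n (p n) = bsrc diagram (Suc n) (p (Suc n))})"
    using address_path topspace_bpath_topology[of diagram] by (simp add: bpath_topology_eq)
next
  fix s n assume "s \<in> topspace (seq_space (bE diagram) {p. \<forall>n. p n \<in> bE diagram n \<and>
      brng diagram n (p n) = bsrc diagram (Suc n) (p (Suc n))})"
  then have "s \<in> bpaths diagram"
    using topspace_bpath_topology[of diagram] by (simp add: bpath_topology_eq)
  then show "\<exists>x\<in>topspace X. \<forall>m<n. address x m = s m" using address_approx by blast
qed

lemma address_onto: "p \<in> bpaths diagram \<Longrightarrow> \<exists>x\<in>topspace X. address x = p"
  using homeomorphic_imp_surjective_map[OF homeomorphic_map_address]
  by (metis imageE topspace_bpath_topology)

lemma min_path_iff: "x \<in> topspace X \<Longrightarrow> min_path diagram (address x) \<longleftrightarrow> (\<forall>n. \<tau> n x = 0)"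
  using min_path_address by (simp add: min_path_def address_path) blast

lemma max_path_iff: "x \<in> topspace X \<Longrightarrow> max_path diagram (address x) \<longleftrightarrow> (\<forall>n. \<tau> n (f x) = 0)"
  using max_path_address by (simp add: max_path_def address_path) blast

lemma diagram_essentially_simple: "essentially_simple diagram"
  unfolding essentially_simple_def
proof
  obtain x where x: "x \<in> topspace X" "\<And>n. \<tau> n x = 0" using base_point_exists by blast
  show "\<exists>!p. min_path diagram p"
  proof (rule ex1I[of _ "address x"])
    show "min_path diagram (address x)" using x by (simp add: min_path_iff)
    fix p assume p: "min_path diagram p"
    then obtain y where "y \<in> topspace X" "p = address y"
      using address_onto by (auto simp: min_path_def)
    then show "p = address x" using base_point[of y x] x p by (simp add: min_path_iff)
  qed
  \<comment> \<open>the maximal path is the preimage of the base point\<close>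
  obtain w where w: "w \<in> topspace X" "f w = x" using f_surj x by blast
  show "\<exists>!p. max_path diagram p"
  proof (rule ex1I[of _ "address w"])
    show "max_path diagram (address w)" using w x by (simp add: max_path_iff)
    fix p assume p: "max_path diagram p"
    then obtain y where y: "y \<in> topspace X" "p = address y"
      using address_onto by (auto simp: max_path_def)
    then have "f y = f w" using base_point[of "f y" x] x w p f_in by (simp add: max_path_iff)
    then show "p = address w" using f_inj y w by auto
  qed
qed

lemma vershik_map_address:
  assumes x: "x \<in> topspace X"
  shows "vershik_map diagram (address x) = address (f x)"
proof (cases "max_path diagram (address x)")
  case True
  then have "min_path diagram (address (f x))"
    using x f_in by (simp add: max_path_iff min_path_iff)
  then have "(THE q. min_path diagram q) = address (f x)"
    using diagram_essentially_simple by (simp add: essentially_simple_def the1_equality)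
  then show ?thesis using True by (simp add: vershik_map_def)
next
  case False
  interpret ordered_diagram diagram by unfold_locales (rule diagram_ordered)
  have "\<exists>n. \<not> max_edge diagram n (address x n)"
    using False address_path[OF x] by (auto simp: max_path_def)
  then obtain n where n: "\<not> max_edge diagram n (address x n)" "\<forall>i<n. max_edge diagram i (address x i)"
    using exists_least_iff[of "\<lambda>n. \<not> max_edge diagram n (address x n)"] by auto
  have \<tau>0: "\<tau> n (f x) = 0" using n(2) max_path_address[OF x] by blast
  have "\<tau> (Suc n) (f x) \<noteq> 0" using n(1) max_path_address[OF x, of "Suc n"] by auto
  then have "\<tau> m (f x) \<noteq> 0" if "Suc n \<le> m" for m
    using base_le[OF f_in[OF x] that] by auto
  then have c: "\<iota> m (f x) = \<iota> m x \<and> \<tau> m (f x) = Suc (\<tau> m x)" if "Suc n \<le> m" for m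
    using climb'[OF x, of m] that by simp
  have fb: "f x \<in> base n" using f_in[OF x] \<tau>0 by (simp add: base_def)
  obtain y where y: "y \<in> base n" "address x n = cell (Suc n) y" 
      "\<iota> (Suc n) y = \<iota> (Suc n) x" "\<tau> (Suc n) y + \<tau> n x = \<tau> (Suc n) x"
    by (rule address_foot[OF x, of n]) auto
  have fa: "address (f x) n = cell (Suc n) (f x)" using \<tau>0 by (simp add: address_def cell_def)
  show ?thesis
  proof (rule vershik_map_eqI[OF address_path[OF x] n address_path[OF f_in[OF x]]])
    show "\<forall>i<n. min_edge diagram i (address (f x) i)"
      using min_path_address[OF f_in[OF x]] \<tau>0 by blast
    show "\<forall>i>n. address (f x) i = address x i"
      using c by (auto simp: address_def)
    have "\<tau> (Suc n) (f x) \<le> \<tau> (Suc n) z"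
      if z: "z \<in> base n" "\<iota> (Suc n) z = \<iota> (Suc n) x" "\<tau> (Suc n) y \<le> \<tau> (Suc n) z"
        "cell (Suc n) z \<noteq> cell (Suc n) y" for z
    proof -
      have "\<tau> (Suc n) y < \<tau> (Suc n) z" using z y(3) by (auto simp: cell_eq_iff)
      then have "\<tau> (Suc n) x < \<tau> (Suc n) z" using y(4) by (intro next_visit[OF x z(1,2)]) simp
      then show ?thesis using c[of "Suc n"] by simp
    qed
    moreover have "\<tau> (Suc n) y \<noteq> \<tau> (Suc n) (f x)" "\<tau> (Suc n) y \<le> \<tau> (Suc n) (f x)"
      using y(4) c[of "Suc n"] by simp_all
    ultimately show "succ_edge diagram n (address x n) (address (f x) n)"
      using fb y(1,3) c[of "Suc n"]
      by (auto simp: succ_edge_iff fa y(2) range_cell in_edges_diagram order_cell cell_eq_iff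
            intro!: exI[of _ "f x"])
  qed
qed

lemma diagram_conjugate: "top_conjugate X f (bpath_topology diagram) (vershik_map diagram)"
  unfolding top_conjugate_def using homeomorphic_map_address vershik_map_address by metis

end

section \<open>From towers to a KR-covering\<close>

lemma set_vwalk_arcs: "set (vwalk_arcs c) = {(c ! k, c ! Suc k) | k. Suc k < length c}"
proof (induction c rule: vwalk_arcs.induct)
  case (3 x y xs)
  have "{(c ! k, c ! Suc k) | k. Suc k < length c} =
      insert (x, y) {((y # xs) ! k, (y # xs) ! Suc k) | k. Suc k < length (y # xs)}"
    (is "?L = ?R") if "c = x # y # xs" for c
  proof
    show "?L \<subseteq> ?R"
    proof
      fix a assume "a \<in> ?L"
      then obtain k where k: "a = (c ! k, c ! Suc k)" "Suc k < length c" by blast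
      then show "a \<in> ?R" using that by (cases k) auto
    qed
    show "?R \<subseteq> ?L"
    proof
      fix a assume "a \<in> ?R"
      then consider "a = (x, y)" |
        k where "a = ((y # xs) ! k, (y # xs) ! Suc k)" "Suc k < length (y # xs)" by blast
      then show "a \<in> ?L"
      proof cases
        case 1
        then show ?thesis using that by (intro CollectI exI[of _ 0]) simp
      next
        case 2
        then show ?thesis using that by (intro CollectI exI[of _ "Suc k"]) simp
      qed
    qed
  qed
  then show ?case using 3 by simp
qed auto

lemma invlim_topology_eq: "invlim_topology G \<phi> =
    seq_space (\<lambda>n. pverts (G n)) {x. \<forall>n. x n = \<phi> (Suc n) (x (Suc n))}"
  by (simp add: invlim_topology_def seq_space_def)

context proper_tower_system
begin

text \<open>The bottom floors of all towers get the same label 0, which is the center of the graph.\<close>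
definition label :: "nat \<Rightarrow> nat \<Rightarrow> nat" where
  "label i k = (if k = 0 then 0 else Suc (prod_encode (i, k)))"

definition vertex :: "nat \<Rightarrow> 'a \<Rightarrow> nat" where
  "vertex n x = label (\<iota> n x) (\<tau> n x)"

text \<open>
  The graph is the image of the orbit relation, so that vertices and arcs are exactly those that occur
  in the system; surjectivity of the bonding maps on arcs then needs no argument.
\<close>
definition graph :: "nat \<Rightarrow> nat pair_pre_digraph" where
  "graph n = \<lparr>pverts = vertex n ` topspace X, parcs = (\<lambda>x. (vertex n x, vertex n (f x))) ` topspace X\<rparr>"

definition bond :: "nat \<Rightarrow> nat \<Rightarrow> nat" where
  "bond n u = vertex (n - 1) (inv_into (topspace X) (vertex n) u)"

definition tower_circuit :: "nat \<Rightarrow> nat \<Rightarrow> nat list" where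
  "tower_circuit n i = map (\<lambda>k. label i (k mod H n i)) [0..<Suc (H n i)]"

lemma label_eq_0_iff: "label i k = 0 \<longleftrightarrow> k = 0"
  by (simp add: label_def)

lemma label_eq_iff: "label i k = label j l \<longleftrightarrow> k = l \<and> (k = 0 \<or> i = j)"
  by (auto simp: label_def prod_encode_eq)

lemma vertex_eq_iff: "vertex n x = vertex n y \<longleftrightarrow> \<tau> n x = \<tau> n y \<and> (\<tau> n x = 0 \<or> \<iota> n x = \<iota> n y)"
  by (auto simp: vertex_def label_eq_iff)

lemma vertex_eq_0_iff: "vertex n x = 0 \<longleftrightarrow> \<tau> n x = 0"
  by (simp add: vertex_def label_eq_0_iff)

lemma vertex_image:
  assumes "x \<in> topspace X"
  shows "vertex n (f x) = label (\<iota> n x) (Suc (\<tau> n x) mod H n (\<iota> n x))"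
proof (cases "\<tau> n (f x) = 0")
  case True
  then show ?thesis using base_iff_top[OF assms, of n] by (simp add: vertex_def label_def)
next
  case False
  have "Suc (\<tau> n x) < H n (\<iota> n x)"
    using False base_iff_top[OF assms, of n] below[OF assms, of n] by linarith
  then show ?thesis using climb'[OF assms False] by (simp add: vertex_def)
qed

lemma vertex_refine:
  assumes "x \<in> topspace X" "y \<in> topspace X" "vertex (Suc n) x = vertex (Suc n) y"
  shows "vertex n x = vertex n y"
  using assms(3) refine[OF assms(1,2)] base_Suc[OF assms(1)] base_Suc[OF assms(2)]
  by (auto simp: vertex_eq_iff)

lemma bond_vertex:
  assumes "x \<in> topspace X"
  shows "bond (Suc n) (vertex (Suc n) x) = vertex n x"
proof -
  let ?y = "inv_into (topspace X) (vertex (Suc n)) (vertex (Suc n) x)"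
  have "?y \<in> topspace X" "vertex (Suc n) ?y = vertex (Suc n) x"
    using assms by (auto intro: inv_into_into f_inv_into_f)
  then show ?thesis using vertex_refine[of ?y x n] assms by (simp add: bond_def)
qed

text \<open>
  This is +directionality. The only vertex of level \<open>n + 1\<close> with several successors is the center, and
  points over the center lie in one tower of level \<open>n\<close>.
\<close>
lemma vertex_step:
  assumes x: "x \<in> topspace X" and y: "y \<in> topspace X" and eq: "vertex (Suc n) x = vertex (Suc n) y"
  shows "vertex n (f x) = vertex n (f y)"
proof -
  have "\<iota> n x = \<iota> n y \<and> \<tau> n x = \<tau> n y"
  proof (cases "\<tau> (Suc n) x = 0")
    case True
    then have "\<tau> (Suc n) y = 0" using eq by (simp add: vertex_eq_iff)
    then show ?thesis using True proper[OF x y] base_Suc x y by simp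
  next
    case False
    then show ?thesis using eq refine[OF x y] by (simp add: vertex_eq_iff)
  qed
  then show ?thesis using x y by (simp add: vertex_image)
qed

lemma finite_graph: "finite (pverts (graph n))"
proof -
  have "pverts (graph n) \<subseteq> (\<lambda>(i, k). label i k) ` (SIGMA i:\<iota> n ` topspace X. {..<H n i})"
    using below by (auto simp: graph_def vertex_def)
  then show ?thesis by (rule finite_subset) (use finite_towers in auto)
qed

lemma fin_graph_graph: "fin_graph (graph n)"
  unfolding fin_graph_def
proof
  show "pair_fin_digraph (graph n)"
  proof
    show "finite (pverts (graph n))" by (rule finite_graph)
    show "fst e \<in> pverts (graph n)" "snd e \<in> pverts (graph n)" if "e \<in> parcs (graph n)" for e
      using that f_in by (auto simp: graph_def)
    then have "parcs (graph n) \<subseteq> pverts (graph n) \<times> pverts (graph n)" by auto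
    then show "finite (parcs (graph n))" using finite_graph by (meson finite_SigmaI finite_subset)
  qed
  show "\<forall>v\<in>pverts (graph n). (\<exists>u. (u, v) \<in> parcs (graph n)) \<and> (\<exists>w. (v, w) \<in> parcs (graph n))"
  proof
    fix v assume "v \<in> pverts (graph n)"
    then obtain x where x: "x \<in> topspace X" "v = vertex n x" by (auto simp: graph_def)
    then obtain y where "y \<in> topspace X" "f y = x" using f_surj by blast
    then have "(vertex n y, v) \<in> parcs (graph n)" "(v, vertex n (f x)) \<in> parcs (graph n)"
      using x by (auto simp: graph_def)
    then show "(\<exists>u. (u, v) \<in> parcs (graph n)) \<and> (\<exists>w. (v, w) \<in> parcs (graph n))" by blast
  qed
qed

lemma graph_cover_bond: "graph_cover (graph (Suc n)) (graph n) (bond (Suc n))"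
proof -
  have "map_prod (bond (Suc n)) (bond (Suc n)) ` parcs (graph (Suc n)) = parcs (graph n)"
    unfolding graph_def by (simp add: image_image bond_vertex f_in cong: image_cong_simp)
  moreover have "bond (Suc n) ` pverts (graph (Suc n)) \<subseteq> pverts (graph n)"
    by (auto simp: graph_def bond_vertex)
  moreover have "plus_directional (graph (Suc n)) (bond (Suc n))"
    unfolding plus_directional_def
  proof (intro allI impI)
    fix u v v' assume "(u, v) \<in> parcs (graph (Suc n)) \<and> (u, v') \<in> parcs (graph (Suc n))"
    then obtain x y where "x \<in> topspace X" "y \<in> topspace X" "u = vertex (Suc n) x"
      "u = vertex (Suc n) y" "v = vertex (Suc n) (f x)" "v' = vertex (Suc n) (f y)"
      by (auto simp: graph_def)
    then show "bond (Suc n) v = bond (Suc n) v'"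
      using vertex_step[of x y n] by (simp add: bond_vertex f_in)
  qed
  ultimately show ?thesis
    unfolding graph_cover_def graph_hom_def edge_surjective_def by force
qed

lemma tower_circuit_nth: "k \<le> H n i \<Longrightarrow> tower_circuit n i ! k = label i (k mod H n i)"
  by (simp add: tower_circuit_def del: upt_Suc)

lemma length_tower_circuit: "length (tower_circuit n i) = Suc (H n i)"
  by (simp add: tower_circuit_def)

lemma cell_exists:
  assumes "i \<in> \<iota> n ` topspace X" "k < H n i"
  shows "\<exists>x\<in>topspace X. \<iota> n x = i \<and> \<tau> n x = k"
proof -
  obtain x where x: "x \<in> topspace X" "i = \<iota> n x" using assms(1) by blast
  obtain z where z: "z \<in> topspace X" "\<tau> n z = 0" "\<iota> n z = \<iota> n x"
    by (rule descend[OF x(1), of n]) auto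
  show ?thesis
    using ascend[OF z(1), of n k n] z assms(2) x(2) by auto
qed

lemma tower_circuit_arcs:
  assumes i: "i \<in> \<iota> n ` topspace X"
  shows "set (vwalk_arcs (tower_circuit n i)) = 
     (\<lambda>x. (vertex n x, vertex n (f x))) ` {x \<in> topspace X. \<iota> n x = i}" (is "?L = ?R")
proof
  show "?L \<subseteq> ?R"
  proof
    fix a assume "a \<in> ?L"
    then obtain k where k: "k < H n i" "a = (tower_circuit n i ! k, tower_circuit n i ! Suc k)"
      by (auto simp: set_vwalk_arcs length_tower_circuit)
    obtain x where "x \<in> topspace X" "\<iota> n x = i" "\<tau> n x = k" using cell_exists[OF i k(1)] by blast
    then have "x \<in> {x \<in> topspace X. \<iota> n x = i}" "a = (vertex n x, vertex n (f x))"
      using k by (simp_all add: tower_circuit_nth vertex_image) (simp add: vertex_def)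
    then show "a \<in> ?R" by blast
  qed
  show "?R \<subseteq> ?L"
  proof
    fix a assume "a \<in> ?R"
    then obtain x where x: "x \<in> topspace X" "\<iota> n x = i" "a = (vertex n x, vertex n (f x))" by auto
    then have "\<tau> n x < H n i" "a = (tower_circuit n i ! \<tau> n x, tower_circuit n i ! Suc (\<tau> n x))"
      using below[OF x(1), of n] by (auto simp: tower_circuit_nth vertex_image) (simp add: vertex_def)
    then show "a \<in> ?L" by (auto simp: set_vwalk_arcs length_tower_circuit)
  qed
qed

lemma set_tower_circuit: "set (tower_circuit n i) = (\<lambda>k. label i (k mod H n i)) ` {..H n i}"
  by (auto simp: tower_circuit_def simp del: upt_Suc)

lemma circuit_tower_circuit:
  assumes i: "i \<in> \<iota> n ` topspace X"
  shows "circuit (graph n) (tower_circuit n i)" "hd (tower_circuit n i) = 0"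
proof -
  have H: "0 < H n i" using i below[of _ n] by (metis gr0I imageE not_less0)
  have "label i k \<in> pverts (graph n)" if "k < H n i" for k
    using cell_exists[OF i that] by (auto simp: graph_def vertex_def)
  then have "set (tower_circuit n i) \<subseteq> pverts (graph n)" using H by (auto simp: set_tower_circuit)
  moreover have "set (vwalk_arcs (tower_circuit n i)) \<subseteq> parcs (graph n)"
    unfolding tower_circuit_arcs[OF i] by (auto simp: graph_def)
  moreover have "tower_circuit n i \<noteq> []" using length_tower_circuit[of n i] by auto
  moreover show "hd (tower_circuit n i) = 0"
    using tower_circuit_nth[of 0 n i] \<open>tower_circuit n i \<noteq> []\<close> by (simp add: hd_conv_nth label_def)
  moreover have "last (tower_circuit n i) = 0"
    using tower_circuit_nth[of "H n i" n i] \<open>tower_circuit n i \<noteq> []\<close> by (simp add: last_conv_nth length_tower_circuit label_def)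
  moreover have "distinct (butlast (tower_circuit n i))"
  proof -
    have "butlast (tower_circuit n i) = map (\<lambda>k. label i (k mod H n i)) [0..<H n i]"
      by (simp add: tower_circuit_def)
    also have "\<dots> = map (label i) [0..<H n i]" by simp
    finally show ?thesis by (simp add: distinct_map inj_on_def label_eq_iff)
  qed
  ultimately show "circuit (graph n) (tower_circuit n i)"
    using H by (simp add: circuit_def vwalk_def length_tower_circuit)
qed

text \<open>
  The circuits are counted as walks, not as towers: all towers of height 1 yield the same loop at the
  center.
\<close>
lemma figure_8: "generalized_figure_8 (graph n) 0 (card (tower_circuit n ` \<iota> n ` topspace X))"
  unfolding generalized_figure_8_def
proof (intro exI[of _ "tower_circuit n ` \<iota> n ` topspace X"] conjI ballI impI)
  show "finite (tower_circuit n ` \<iota> n ` topspace X)" using finite_towers by blast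
  show "circuit (graph n) c" "hd c = 0" if "c \<in> tower_circuit n ` \<iota> n ` topspace X" for c
  proof -
    obtain i where "i \<in> \<iota> n ` topspace X" "c = tower_circuit n i" using \<open>c \<in> _\<close> by (rule imageE)
    then show "circuit (graph n) c" "hd c = 0" using circuit_tower_circuit[of i n] by simp_all
  qed
  show "set c \<inter> set d = {0}"
    if c: "c \<in> tower_circuit n ` \<iota> n ` topspace X" and d: "d \<in> tower_circuit n ` \<iota> n ` topspace X" and ne: "c \<noteq> d" for c d
  proof -
    obtain i j where ij: "i \<in> \<iota> n ` topspace X" "j \<in> \<iota> n ` topspace X" "c = tower_circuit n i" "d = tower_circuit n j"
      using c d by blast
    have "hd (tower_circuit n i) \<in> set c" "hd (tower_circuit n j) \<in> set d" 
      using ij length_tower_circuit by (metis hd_in_set list.size(3) nat.simps(3))+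
    then have "0 \<in> set c \<inter> set d" using circuit_tower_circuit(2) ij by simp
    moreover have "u = 0" if "u \<in> set c \<inter> set d" for u
    proof -
      have "u \<in> set (tower_circuit n i)" "u \<in> set (tower_circuit n j)" using that ij by simp_all
      then obtain k l where "u = label i k" "u = label j l" unfolding set_tower_circuit by blast
      then show ?thesis using ne ij(3,4) label_eq_iff label_eq_0_iff by metis
    qed
    ultimately show ?thesis by blast
  qed
  show "parcs (graph n) = (\<Union>c\<in>tower_circuit n ` \<iota> n ` topspace X. set (vwalk_arcs c))"
    by (auto simp: tower_circuit_arcs graph_def)
qed (rule refl)

lemma KR_covering_graph: "KR_covering graph bond (\<lambda>n. 0) (\<lambda>n. card (tower_circuit n ` \<iota> n ` topspace X))"
  unfolding KR_covering_def graph_covering_def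
proof (intro conjI allI exI)
  obtain b where b: "b \<in> topspace X" "\<And>n. \<tau> n b = 0" using base_point_exists by blast
  have v0: "vertex 0 x = 0" if "x \<in> topspace X" for x using that root_base by (simp add: vertex_eq_0_iff)
  show "pverts (graph 0) = {0}" "parcs (graph 0) = {(0, 0)}"
    using b v0 f_in by (auto simp: graph_def image_iff)
  fix n
  show "fin_graph (graph n)" by (rule fin_graph_graph)
  show "graph_cover (graph (Suc n)) (graph n) (bond (Suc n))" by (rule graph_cover_bond)
  show "generalized_figure_8 (graph n) 0 (card (tower_circuit n ` \<iota> n ` topspace X))" by (rule figure_8)
  have vb: "vertex n b = 0" for n using b by (simp add: vertex_eq_0_iff)
  show "0 \<in> pverts (graph n)" using b(1) vb[of n] by (auto simp: graph_def image_iff intro!: bexI[of _ b])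
  show "bond (Suc n) 0 = 0" using bond_vertex[OF b(1), of n] vb by simp
qed

definition itinerary :: "'a \<Rightarrow> nat \<Rightarrow> nat" where
  "itinerary x n = vertex n x"

text \<open>
  The vertex forgets the tower of a point in the base. This loses nothing in the limit: a point
  other than the base point leaves the bases from some level on, and floors of high levels
  determine those of low levels.
\<close>
lemma itinerary_inj: "inj_on itinerary (topspace X)"
proof (rule inj_onI)
  fix x y assume xy: "x \<in> topspace X" "y \<in> topspace X" "itinerary x = itinerary y"
  have eq: "vertex n x = vertex n y" for n using xy(3) by (simp add: itinerary_def fun_eq_iff)
  show "x = y"
  proof (cases "\<forall>n. \<tau> n x = 0")
    case True
    then have "\<forall>n. \<tau> n y = 0" using eq by (simp add: vertex_eq_iff)
    then show ?thesis using True base_point xy by blast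
  next
    case False
    then obtain N where N: "\<tau> N x \<noteq> 0" by blast
    have "\<iota> n x = \<iota> n y \<and> \<tau> n x = \<tau> n y" for n
    proof -
      have "\<tau> (max N n) x \<noteq> 0" using base_le[OF xy(1) max.cobounded1, of N n] N by auto
      then show ?thesis
        using eq[of "max N n"] refine_le[OF xy(1,2) max.cobounded2, of N n] by (simp add: vertex_eq_iff)
    qed
    then show ?thesis using separate xy by blast
  qed
qed

lemma homeomorphic_map_itinerary: "homeomorphic_map X (invlim_topology graph bond) itinerary"
  unfolding invlim_topology_eq
proof (rule homeomorphic_map_seq_space[OF compact _ _ itinerary_inj])
  fix n b
  have "openin X (\<Union>(i, k)\<in>{(i, k). label i k = b}. {x \<in> topspace X. \<iota> n x = i \<and> \<tau> n x = k})"
    by (intro openin_Union) (auto simp: open_cell)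
  moreover have "(\<Union>(i, k)\<in>{(i, k). label i k = b}. {x \<in> topspace X. \<iota> n x = i \<and> \<tau> n x = k}) =
      {x \<in> topspace X. itinerary x n = b}" by (auto simp: itinerary_def vertex_def)
  ultimately show "openin X {x \<in> topspace X. itinerary x n = b}" by simp
next
  fix x assume "x \<in> topspace X"
  then show "itinerary x \<in> topspace (seq_space (\<lambda>n. pverts (graph n)) {x. \<forall>n. x n = bond (Suc n) (x (Suc n))})"
    by (auto simp: topspace_seq_space itinerary_def bond_vertex graph_def)
next
  fix s n assume s: "s \<in> topspace (seq_space (\<lambda>n. pverts (graph n)) {x. \<forall>n. x n = bond (Suc n) (x (Suc n))})"
  then have "s n \<in> pverts (graph n)" unfolding topspace_seq_space by blast
  then obtain x where x: "x \<in> topspace X" "s n = vertex n x" by (auto simp: graph_def)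
  have "s m = vertex m x" if "m \<le> n" for m
    using that
  proof (induction rule: inc_induct)
    case (step m)
    have "s m = bond (Suc m) (s (Suc m))" using s unfolding topspace_seq_space by blast
    then show ?case using step.IH x(1) by (simp add: bond_vertex)
  qed (use x in simp)
  then show "\<exists>x\<in>topspace X. \<forall>m<n. itinerary x m = s m" 
    using x(1) by (intro bexI[of _ x]) (auto simp: itinerary_def)
qed

lemma invlim_map_itinerary:
  assumes x: "x \<in> topspace X"
  shows "invlim_map graph bond (itinerary x) = itinerary (f x)"
  unfolding invlim_map_def
proof (rule the_equality)
  have top: "itinerary z \<in> topspace (invlim_topology graph bond)" if "z \<in> topspace X" for z
    using that homeomorphic_imp_surjective_map[OF homeomorphic_map_itinerary] by blast
  show "itinerary (f x) \<in> topspace (invlim_topology graph bond) \<and>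
      (\<forall>n. (itinerary x n, itinerary (f x) n) \<in> parcs (graph n))"
    using top f_in x by (auto simp: itinerary_def graph_def)
  fix y assume y: "y \<in> topspace (invlim_topology graph bond) \<and>
      (\<forall>n. (itinerary x n, y n) \<in> parcs (graph n))"
  show "y = itinerary (f x)"
  proof
    fix n
    have "(itinerary x (Suc n), y (Suc n)) \<in> parcs (graph (Suc n))" using y by blast
    then obtain z where z: "z \<in> topspace X" "vertex (Suc n) z = vertex (Suc n) x"
      "y (Suc n) = vertex (Suc n) (f z)" by (auto simp: graph_def itinerary_def)
    have "y n = bond (Suc n) (y (Suc n))" 
      using y unfolding invlim_topology_eq topspace_seq_space by blast
    then show "y n = itinerary (f x) n"
      using z vertex_step[OF z(1) x z(2)] f_in by (simp add: bond_vertex itinerary_def)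
  qed
qed

lemma graph_conjugate: "top_conjugate X f (invlim_topology graph bond) (invlim_map graph bond)"
  unfolding top_conjugate_def 
  by (rule exI[of _ itinerary]) (simp add: homeomorphic_map_itinerary invlim_map_itinerary)

end

section \<open>The towers of a KR-covering\<close>

definition arc_at :: "'v list \<Rightarrow> nat \<Rightarrow> 'v \<times> 'v" where
  "arc_at c k = (c ! k, c ! Suc k)"

lemma circuitD:
  assumes "circuit G c"
  shows "1 < length c" "c ! (length c - 1) = c ! 0"
    and "\<And>k l. k < length c - 1 \<Longrightarrow> l < length c - 1 \<Longrightarrow> c ! k = c ! l \<Longrightarrow> k = l"
proof -
  have c: "c \<noteq> []" "last c = hd c" "distinct (butlast c)" "1 \<le> length c - 1"
    using assms by (auto simp: circuit_def vwalk_def)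
  then show "1 < length c" by simp
  show "c ! (length c - 1) = c ! 0" using c by (simp add: last_conv_nth hd_conv_nth)
  fix k l assume kl: "k < length c - 1" "l < length c - 1" "c ! k = c ! l"
  then show "k = l"
    using c(3) nth_eq_iff_index_eq[of "butlast c" k l] by (simp add: nth_butlast)
qed

locale figure_8_circuits =
  fixes G :: "'v pair_pre_digraph" and v0 :: 'v and C :: "'v list set"
  assumes circuits: "c \<in> C \<Longrightarrow> circuit G c"
    and center: "c \<in> C \<Longrightarrow> c ! 0 = v0"
    and meet: "c \<in> C \<Longrightarrow> d \<in> C \<Longrightarrow> c \<noteq> d \<Longrightarrow> set c \<inter> set d = {v0}"
    and exhaust: "parcs G = (\<Union>c\<in>C. set (vwalk_arcs c))"
begin

lemma center_iff:
  assumes "c \<in> C" "k < length c - 1"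
  shows "c ! k = v0 \<longleftrightarrow> k = 0"
  using circuitD(3)[OF circuits[OF assms(1)] assms(2), of 0] center[OF assms(1)] assms(2) by auto

text \<open>Away from the center a vertex lies on one circuit only, and it occurs there once.\<close>
lemma same_vertex:
  assumes "c \<in> C" "d \<in> C" "k < length c - 1" "l < length d - 1" "c ! k = d ! l" "k \<noteq> 0"
  shows "c = d \<and> k = l"
proof -
  have "c ! k \<in> set c" "c ! k \<in> set d"
    using nth_mem[of k c] nth_mem[of l d] assms(3-5) by simp_all
  moreover have "c ! k \<noteq> v0" using center_iff assms by blast
  ultimately have "c = d" using meet[OF assms(1,2)] by blast
  then show ?thesis using circuitD(3)[OF circuits[OF assms(1)]] assms(3-5) by blast
qed

text \<open>
  An arc that starts at the center is identified by its end, unless it is a loop, and then the circuit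
  is that loop.
\<close>
lemma arc_unique:
  assumes c: "c \<in> C" "k < length c - 1" and d: "d \<in> C" "l < length d - 1" and eq: "arc_at c k = arc_at d l"
  shows "c = d \<and> k = l"
proof (cases "k = 0")
  case False
  then show ?thesis using same_vertex[OF c(1) d(1) c(2) d(2)] eq by (simp add: arc_at_def)
next
  case k: True
  then have l: "l = 0" using eq center_iff[OF c] center_iff[OF d] by (simp add: arc_at_def)
  have eq1: "c ! 1 = d ! 1" using eq k l by (simp add: arc_at_def)
  have len: "1 < length c" "1 < length d" using circuitD(1) circuits c d by blast+
  have "c = d"
  proof (rule ccontr)
    assume "c \<noteq> d"
    moreover have "c ! 1 \<in> set c" "c ! 1 \<in> set d"
      using nth_mem[OF len(1)] nth_mem[OF len(2)] unfolding eq1 by blast+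
    ultimately have "c ! 1 = v0" using meet[OF c(1) d(1)] by blast
    then have v: "c ! 1 = v0" "d ! 1 = v0" using eq1 by simp_all
    have "\<not> 1 < length c - 1" "\<not> 1 < length d - 1"
      using v center_iff[OF c(1), of 1] center_iff[OF d(1), of 1] by auto
    then have "length c = 2" "length d = 2" using len by linarith+
    then have "c = d" using center c d v by (auto simp: list_eq_iff_nth_eq less_2_cases_iff)
    then show False using \<open>c \<noteq> d\<close> by simp
  qed
  then show ?thesis using k l by simp
qed

lemma arc_exists:
  assumes "a \<in> parcs G"
  shows "\<exists>c\<in>C. \<exists>k<length c - 1. a = arc_at c k"
proof -
  obtain c where c: "c \<in> C" "a \<in> set (vwalk_arcs c)" using assms exhaust by blast
  then obtain k where "a = arc_at c k" "Suc k < length c" by (auto simp: set_vwalk_arcs arc_at_def)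
  then show ?thesis using c(1) by (intro bexI[of _ c] exI[of _ k]) auto
qed

definition circuit_of :: "'v \<times> 'v \<Rightarrow> 'v list" where
  "circuit_of a = (THE c. c \<in> C \<and> (\<exists>k<length c - 1. a = arc_at c k))"

definition position_of :: "'v \<times> 'v \<Rightarrow> nat" where
  "position_of a = (THE k. k < length (circuit_of a) - 1 \<and> a = arc_at (circuit_of a) k)"

lemma located:
  assumes "c \<in> C" "k < length c - 1"
  shows "circuit_of (arc_at c k) = c" "position_of (arc_at c k) = k"
proof -
  show *: "circuit_of (arc_at c k) = c"
    unfolding circuit_of_def using arc_unique[OF _ _ assms] assms by (intro the_equality) (blast, metis)
  show "position_of (arc_at c k) = k"
    unfolding position_of_def * using arc_unique[OF assms(1) _ assms] assms(2) by (intro the_equality) (blast, metis)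
qed

lemma locate:
  assumes "a \<in> parcs G"
  shows "circuit_of a \<in> C" "position_of a < length (circuit_of a) - 1"
    "arc_at (circuit_of a) (position_of a) = a"
proof -
  obtain c k where "c \<in> C" "k < length c - 1" "a = arc_at c k" using arc_exists[OF assms] by blast
  then show "circuit_of a \<in> C" "position_of a < length (circuit_of a) - 1"
    "arc_at (circuit_of a) (position_of a) = a"
    using located[of c k] by simp_all
qed

lemma position_0_iff: 
  assumes "a \<in> parcs G"
  shows "position_of a = 0 \<longleftrightarrow> fst a = v0"
  using locate[OF assms] center_iff[of "circuit_of a" "position_of a"]
  by (metis arc_at_def fst_conv)

lemma next_arc:
  assumes a: "a \<in> parcs G" and b: "b \<in> parcs G" and eq: "snd a = fst b"
  shows "Suc (position_of a) < length (circuit_of a) - 1 \<Longrightarrow>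
      circuit_of b = circuit_of a \<and> position_of b = Suc (position_of a)"
    and "Suc (position_of a) = length (circuit_of a) - 1 \<Longrightarrow> position_of b = 0"
proof -
  let ?c = "circuit_of a" let ?k = "position_of a"
  note la = locate[OF a] and lb = locate[OF b]
  have eq': "?c ! Suc ?k = circuit_of b ! position_of b"
    using la(3) lb(3) eq unfolding arc_at_def by (metis fst_conv snd_conv)
  show "circuit_of b = ?c \<and> position_of b = Suc ?k" if "Suc ?k < length ?c - 1"
    using same_vertex[OF la(1) lb(1) that lb(2) eq'] by simp
  show "position_of b = 0" if "Suc ?k = length ?c - 1"
    using eq' that circuitD(2)[OF circuits[OF la(1)]] center[OF la(1)] center_iff[OF lb(1,2)] by simp
qed

end

lemma generalized_figure_8_circuits:
  assumes "generalized_figure_8 G v0 r"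
  shows "\<exists>C. finite C \<and> card C = r \<and> figure_8_circuits G v0 C"
proof -
  obtain C where C: "finite C" "card C = r" and circ: "\<forall>c\<in>C. circuit G c \<and> hd c = v0"
    and meet: "\<forall>c\<in>C. \<forall>d\<in>C. c \<noteq> d \<longrightarrow> set c \<inter> set d = {v0}"
    and arcs: "parcs G = (\<Union>c\<in>C. set (vwalk_arcs c))"
    using assms unfolding generalized_figure_8_def by (elim exE conjE)
  have "figure_8_circuits G v0 C"
  proof
    show "circuit G c" if "c \<in> C" for c using circ that by blast
    show "c ! 0 = v0" if "c \<in> C" for c
      using circ that circuitD(1)[of G c] hd_conv_nth[of c] by fastforce
    show "set c \<inter> set d = {v0}" if "c \<in> C" "d \<in> C" "c \<noteq> d" for c d
      using meet that by blast
  qed (rule arcs)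
  then show ?thesis using C by blast
qed

text \<open>
  For a general covering the shift on the inverse limit is a continuous surjection only. It is
  assumed to be bijective because the covering is to model a homeomorphism.
\<close>
locale KR_covering_system =
  fixes G :: "nat \<Rightarrow> 'v::countable pair_pre_digraph" and \<phi> :: "nat \<Rightarrow> 'v \<Rightarrow> 'v"
    and v0 :: "nat \<Rightarrow> 'v" and r :: "nat \<Rightarrow> nat"
  assumes KR: "KR_covering G \<phi> v0 r"
    and bij_map: "bij_betw (invlim_map G \<phi>) (topspace (invlim_topology G \<phi>)) (topspace (invlim_topology G \<phi>))"
begin

abbreviation "Y \<equiv> invlim_topology G \<phi>"
abbreviation "g \<equiv> invlim_map G \<phi>"

lemma topspace_Y: "y \<in> topspace Y \<longleftrightarrow> (\<forall>n. y n = \<phi> (Suc n) (y (Suc n))) \<and> (\<forall>n. y n \<in> pverts (G n))"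
  by (auto simp: invlim_topology_eq topspace_seq_space)

lemma bond_Y: "y \<in> topspace Y \<Longrightarrow> \<phi> (Suc n) (y (Suc n)) = y n"
  unfolding topspace_Y by metis

lemma cover: "graph_cover (G (Suc n)) (G n) (\<phi> (Suc n))"
  and fin: "fin_graph (G n)"
  and center_bond: "\<phi> (Suc n) (v0 (Suc n)) = v0 n"
  and center_in: "v0 n \<in> pverts (G n)"
  and fig8: "generalized_figure_8 (G n) (v0 n) (r n)"
  using KR by (simp_all add: KR_covering_def graph_covering_def)

lemma bond_arc: "(u, v) \<in> parcs (G (Suc n)) \<Longrightarrow> (\<phi> (Suc n) u, \<phi> (Suc n) v) \<in> parcs (G n)"
  using cover[of n] by (simp add: graph_cover_def graph_hom_def)

lemma bond_directional:
  "(u, v) \<in> parcs (G (Suc n)) \<Longrightarrow> (u, v') \<in> parcs (G (Suc n)) \<Longrightarrow> \<phi> (Suc n) v = \<phi> (Suc n) v'"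
  using cover[of n] unfolding graph_cover_def plus_directional_def by blast

lemma arc_wf: "(u, v) \<in> parcs (G n) \<Longrightarrow> u \<in> pverts (G n) \<and> v \<in> pverts (G n)"
  using fin[of n] pair_wf_digraph.in_arcsD1 pair_wf_digraph.in_arcsD2
  unfolding fin_graph_def pair_fin_digraph_def by metis

text \<open>
  By +directionality all successors of the coordinate at level \<open>n + 1\<close> have the same image at level \<open>n\<close>.
  These images are the only possible value of the shift, and they form a point of the limit.
\<close>
lemma g_spec:
  assumes y: "y \<in> topspace Y"
  shows "g y \<in> topspace Y \<and> (\<forall>n. (y n, g y n) \<in> parcs (G n))"
proof -
  have "\<exists>w. (y n, w) \<in> parcs (G n)" for n
    using y fin[of n] unfolding topspace_Y fin_graph_def by blast
  then obtain w where w: "\<And>n. (y n, w n) \<in> parcs (G n)" by metis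
  define z where "z n = \<phi> (Suc n) (w (Suc n))" for n
  have arc: "(y n, z n) \<in> parcs (G n)" for n
    using bond_arc[OF w[of "Suc n"]] bond_Y[OF y] by (simp add: z_def)
  have "z n = \<phi> (Suc n) (z (Suc n))" for n
    using bond_directional[OF arc[of "Suc n"] w[of "Suc n"]] by (simp add: z_def)
  then have z: "z \<in> topspace Y" using arc arc_wf unfolding topspace_Y by blast
  have "z' = z" if z': "z' \<in> topspace Y \<and> (\<forall>n. (y n, z' n) \<in> parcs (G n))" for z'
  proof
    fix n
    have "\<phi> (Suc n) (z' (Suc n)) = \<phi> (Suc n) (z (Suc n))"
      using z' arc by (intro bond_directional[of "y (Suc n)"]) blast+
    then show "z' n = z n" using bond_Y[OF z, of n] bond_Y[of z' n] z' by simp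
  qed
  then have "\<exists>!z. z \<in> topspace Y \<and> (\<forall>n. (y n, z n) \<in> parcs (G n))"
    using z arc by blast
  then show ?thesis unfolding invlim_map_def by (rule theI')
qed

lemma g_in: "y \<in> topspace Y \<Longrightarrow> g y \<in> topspace Y"
  using g_spec by blast

definition circs :: "nat \<Rightarrow> 'v list set" where
  "circs n = (SOME C. finite C \<and> card C = r n \<and> figure_8_circuits (G n) (v0 n) C)"

lemma circs: "finite (circs n)" "card (circs n) = r n" "figure_8_circuits (G n) (v0 n) (circs n)"
  using someI_ex[OF generalized_figure_8_circuits[OF fig8[of n]]]
  unfolding circs_def[symmetric] by simp_all

sublocale figure_8_circuits "G n" "v0 n" "circs n" for n
  by (rule circs)

definition arc :: "nat \<Rightarrow> (nat \<Rightarrow> 'v) \<Rightarrow> 'v \<times> 'v" where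
  "arc n y = (y n, g y n)"

lemma arc_in: "y \<in> topspace Y \<Longrightarrow> arc n y \<in> parcs (G n)"
  using g_spec by (simp add: arc_def)

lemma arc_Suc: 
  assumes "y \<in> topspace Y"
  shows "map_prod (\<phi> (Suc n)) (\<phi> (Suc n)) (arc (Suc n) y) = arc n y"
  using bond_Y[OF assms] bond_Y[OF g_in[OF assms]] by (simp add: arc_def)

definition tower :: "nat \<Rightarrow> (nat \<Rightarrow> 'v) \<Rightarrow> nat" where
  "tower n y = to_nat (circuit_of n (arc n y))"

definition position :: "nat \<Rightarrow> (nat \<Rightarrow> 'v) \<Rightarrow> nat" where
  "position n y = position_of n (arc n y)"

definition height :: "nat \<Rightarrow> nat" where
  "height i = length (from_nat i :: 'v list) - 1"

lemma height_tower: "height (tower n y) = length (circuit_of n (arc n y)) - 1"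
  by (simp add: height_def tower_def)

lemma cell_arc:
  assumes "x \<in> topspace Y" "y \<in> topspace Y"
  shows "tower n x = tower n y \<and> position n x = position n y \<longleftrightarrow> arc n x = arc n y"
proof
  assume "tower n x = tower n y \<and> position n x = position n y"
  then have eq: "circuit_of n (arc n x) = circuit_of n (arc n y)" "position_of n (arc n x) = position_of n (arc n y)"
    by (simp_all add: tower_def position_def)
  have "arc n x = arc_at (circuit_of n (arc n x)) (position_of n (arc n x))"
    by (rule locate(3)[OF arc_in[OF assms(1)], symmetric])
  also have "\<dots> = arc n y"
    unfolding eq by (rule locate(3)[OF arc_in[OF assms(2)]])
  finally show "arc n x = arc n y" .
qed (simp add: tower_def position_def)

lemma position_0: "y \<in> topspace Y \<Longrightarrow> position n y = 0 \<longleftrightarrow> y n = v0 n"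
  using position_0_iff[OF arc_in] by (simp add: position_def arc_def)

lemma finite_verts: "finite (pverts (G n))"
  using fin[of n] by (simp add: fin_graph_def pair_fin_digraph_def pair_fin_digraph_axioms_def)

lemma towers_le: "card (tower n ` topspace Y) \<le> r n" "finite (tower n ` topspace Y)"
proof -
  have sub: "tower n ` topspace Y \<subseteq> to_nat ` circs n"
    using locate(1)[OF arc_in] by (auto simp: tower_def)
  show "card (tower n ` topspace Y) \<le> r n"
    using card_mono[OF finite_imageI[OF circs(1)] sub] card_image_le[OF circs(1), of to_nat n] circs(2)
    by (simp add: le_trans)
  show "finite (tower n ` topspace Y)" using sub circs(1) finite_subset by blast
qed

text \<open>
  The tower and the floor of a point are equivalent to its arc (lemma \<open>cell_arc\<close>), and the bonding
  maps send arcs to arcs; this gives refinement. A floor depends on one coordinate more than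
  its level, as the shifted coordinate is read off one level above.
\<close>
lemma tower_system: "tower_system Y g tower position (\<lambda>n. height)"
proof
  show "compact_space Y"
    unfolding invlim_topology_eq by (rule compact_seq_space[OF finite_verts, where P = "\<lambda>n u v. u = \<phi> (Suc n) v"])
  have "v0 \<in> topspace Y" using center_in center_bond unfolding topspace_Y by simp
  then show "topspace Y \<noteq> {}" by blast
  show "bij_betw g (topspace Y) (topspace Y)" by (rule bij_map)
  fix n
  show "finite (tower n ` topspace Y)" by (rule towers_le)
  show "openin Y {y \<in> topspace Y. tower n y = i \<and> position n y = k}" for i k
  proof (rule openin_seq_space_prefix[OF invlim_topology_eq, where N = "Suc (Suc n)"])
    fix y z assume y: "y \<in> topspace Y" and z: "z \<in> topspace Y" and eq: "\<forall>i<Suc (Suc n). y i = z i"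
      and "tower n y = i \<and> position n y = k"
    have "(y (Suc n), g y (Suc n)) \<in> parcs (G (Suc n))" "(z (Suc n), g z (Suc n)) \<in> parcs (G (Suc n))"
      using g_spec y z by blast+
    then have "g y n = g z n"
      using bond_directional[of "y (Suc n)" "g y (Suc n)" n "g z (Suc n)"] eq
        bond_Y[OF g_in[OF y]] bond_Y[OF g_in[OF z]] by simp
    then have "arc n y = arc n z" using eq by (simp add: arc_def)
    then show "tower n z = i \<and> position n z = k"
      using \<open>tower n y = i \<and> position n y = k\<close> by (simp add: tower_def position_def)
  qed
  fix y assume y: "y \<in> topspace Y"
  show "position n y < height (tower n y)"
    using locate(2)[OF arc_in[OF y]] by (simp add: height_tower position_def)
  have meets: "snd (arc n y) = fst (arc n (g y))" by (simp add: arc_def)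
  show "tower n (g y) = tower n y \<and> position n (g y) = Suc (position n y)"
    if "Suc (position n y) < height (tower n y)"
    using next_arc(1)[OF arc_in[OF y] arc_in[OF g_in[OF y]] meets] that
    unfolding height_tower by (simp add: tower_def position_def)
  show "position n (g y) = 0" if "Suc (position n y) = height (tower n y)"
    using next_arc(2)[OF arc_in[OF y] arc_in[OF g_in[OF y]] meets] that
    unfolding height_tower by (simp add: position_def)
  show "position n y = 0" if "position (Suc n) y = 0"
    using that position_0[OF y] bond_Y[OF y, of n] center_bond[of n] by simp
  obtain v where v: "pverts (G 0) = {v}" "parcs (G 0) = {(v, v)}"
    using KR by (auto simp: KR_covering_def graph_covering_def)
  have "y 0 \<in> pverts (G 0)" using y unfolding topspace_Y by blast
  then show "position 0 y = 0" using v center_in[of 0] position_0[OF y] by simp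
  fix z assume z: "z \<in> topspace Y"
  show "tower 0 y = tower 0 z" using arc_in[OF y, of 0] arc_in[OF z, of 0] v by (simp add: tower_def)
  show "tower n y = tower n z \<and> position n y = position n z"
    if "tower (Suc n) y = tower (Suc n) z" "position (Suc n) y = position (Suc n) z"
  proof -
    have "arc (Suc n) y = arc (Suc n) z" using cell_arc[OF y z] that by blast
    then have "arc n y = arc n z" using arc_Suc[OF y] arc_Suc[OF z] by metis
    then show ?thesis using cell_arc[OF y z] by blast
  qed
  show "y = z" if "\<And>n. tower n y = tower n z \<and> position n y = position n z"
    using that cell_arc[OF y z] by (auto simp: arc_def)
  show "y = z" if "\<And>n. position n y = 0" "\<And>n. position n z = 0"
    using that position_0[OF y] position_0[OF z] by auto
qed

end

section \<open>The towers of an ordered Bratteli diagram\<close>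

text \<open>The number of paths from the root to a vertex, which is the height of its tower.\<close>
primrec path_count :: "('v, 'e, 'm) bratteli_scheme \<Rightarrow> nat \<Rightarrow> 'v \<Rightarrow> nat" where
  "path_count B 0 v = 1"
| "path_count B (Suc n) v = (\<Sum>e\<in>in_edges B n v. path_count B n (bsrc B n e))"

definition edges_below :: "('v, 'e) ordered_bratteli \<Rightarrow> nat \<Rightarrow> 'e \<Rightarrow> 'e set" where
  "edges_below B n e = {d \<in> in_edges B n (brng B n e). (d, e) \<in> bord B n (brng B n e) \<and> d \<noteq> e}"

text \<open>
  The number of paths of length \<open>n\<close> with the same end that precede the initial segment of \<open>p\<close> in the
  reverse lexicographic order: those with a smaller last edge, and those with the same last edge
  whose remaining part precedes that of \<open>p\<close>.
\<close>
primrec path_index :: "('v, 'e) ordered_bratteli \<Rightarrow> nat \<Rightarrow> (nat \<Rightarrow> 'e) \<Rightarrow> nat" where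
  "path_index B 0 p = 0"
| "path_index B (Suc n) p =
     path_index B n p + (\<Sum>d\<in>edges_below B n (p n). path_count B n (bsrc B n d))"

context ordered_diagram
begin

lemma bpathsD:
  assumes "p \<in> bpaths B"
  shows "p n \<in> bE B n" "bsrc B (Suc n) (p (Suc n)) = brng B n (p n)"
    "bsrc B n (p n) \<in> bV B n" "brng B n (p n) \<in> bV B (Suc n)" "p n \<in> in_edges B n (brng B n (p n))"
  using assms edge_ends[of "p n" n] by (auto simp: bpaths_def in_edges_def)

lemma path_count_pos: "v \<in> bV B n \<Longrightarrow> 0 < path_count B n v"
proof (induction n arbitrary: v)
  case (Suc n)
  obtain e where e: "e \<in> in_edges B n v" using in_edges_nonempty[OF Suc.prems] by blast
  then have "0 < path_count B n (bsrc B n e)"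
    using Suc.IH edge_ends by (simp add: in_edges_def)
  then show ?case using e by (auto simp: finite_in_edges sum_eq_0_iff intro: gr0I)
qed simp

lemma finite_edges_below: "finite (edges_below B n e)"
  using finite_in_edges by (simp add: edges_below_def)

lemma edges_below_max: "max_edge B n e \<Longrightarrow> in_edges B n (brng B n e) = insert e (edges_below B n e)"
  by (auto simp: max_edge_def edges_below_def in_edges_def)

text \<open>This is the counting form of the fact that no edge lies strictly between \<open>e\<close> and its successor.\<close>
lemma edges_below_succ:
  assumes e: "e \<in> bE B n" and succ: "succ_edge B n e e'"
  shows "edges_below B n e' = insert e (edges_below B n e)"
proof -
  let ?v = "brng B n e"
  have v: "?v \<in> bV B (Suc n)" using edge_ends e by blast
  have e': "e' \<in> in_edges B n ?v" "(e, e') \<in> bord B n ?v" "e' \<noteq> e" "brng B n e' = ?v"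
    "\<And>d. d \<in> in_edges B n ?v \<Longrightarrow> (e, d) \<in> bord B n ?v \<Longrightarrow> d \<noteq> e \<Longrightarrow> (e', d) \<in> bord B n ?v"
    using succ by (auto simp: succ_edge_iff in_edges_def)
  have ein: "e \<in> in_edges B n ?v" using e by (simp add: in_edges_def)
  have "d \<in> insert e (edges_below B n e)" if "d \<in> edges_below B n e'" for d
    using that e' order_total[OF v ein, of d] order_antisym[OF v, of d e']
    unfolding edges_below_def by auto
  moreover have "d \<in> edges_below B n e'" if "d \<in> edges_below B n e" for d
    using that e' order_trans[OF v, of d e e'] order_antisym[OF v, of e e']
    unfolding edges_below_def by auto
  moreover have "e \<in> edges_below B n e'" using ein e' unfolding edges_below_def by auto
  ultimately show ?thesis by blast
qed

lemma not_below_self: "e \<notin> edges_below B n e"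
  by (simp add: edges_below_def)

lemma path_index_less:
  assumes p: "p \<in> bpaths B"
  shows "path_index B n p < path_count B n (bsrc B n (p n))"
proof (induction n)
  case (Suc n)
  have "path_index B (Suc n) p < path_count B n (bsrc B n (p n)) +
      (\<Sum>d\<in>edges_below B n (p n). path_count B n (bsrc B n d))"
    using Suc by simp
  also have "\<dots> = (\<Sum>d\<in>insert (p n) (edges_below B n (p n)). path_count B n (bsrc B n d))"
    by (simp add: finite_edges_below not_below_self)
  also have "\<dots> \<le> (\<Sum>d\<in>in_edges B n (brng B n (p n)). path_count B n (bsrc B n d))"
    using bpathsD(5)[OF p] finite_in_edges by (intro sum_mono2) (auto simp: edges_below_def)
  finally show ?case by (simp add: bpathsD(2)[OF p])
qed simp

lemma path_index_max:
  assumes p: "p \<in> bpaths B" and "\<forall>i<n. max_edge B i (p i)"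
  shows "Suc (path_index B n p) = path_count B n (bsrc B n (p n))"
  using assms(2)
proof (induction n)
  case (Suc n)
  then have "Suc (path_index B n p) = path_count B n (bsrc B n (p n))" by simp
  then have "Suc (path_index B (Suc n) p) =
      (\<Sum>d\<in>insert (p n) (edges_below B n (p n)). path_count B n (bsrc B n d))"
    by (simp add: finite_edges_below not_below_self)
  then show ?case
    using edges_below_max[of n "p n"] Suc.prems by (simp add: bpathsD(2)[OF p])
qed simp

lemma path_index_0_iff:
  assumes p: "p \<in> bpaths B"
  shows "path_index B n p = 0 \<longleftrightarrow> (\<forall>i<n. min_edge B i (p i))"
proof (induction n)
  case (Suc n)
  have "(\<Sum>d\<in>edges_below B n (p n). path_count B n (bsrc B n d)) = 0 \<longleftrightarrow> edges_below B n (p n) = {}"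
  proof -
    have "0 < path_count B n (bsrc B n d)" if "d \<in> edges_below B n (p n)" for d
      using that path_count_pos edge_ends by (auto simp: edges_below_def in_edges_def)
    then show ?thesis by (auto simp: sum_eq_0_iff finite_edges_below)
  qed
  also have "\<dots> \<longleftrightarrow> min_edge B n (p n)"
  proof -
    note v = bpathsD(4)[OF p, of n] and e = bpathsD(5)[OF p, of n]
    have "(p n, d) \<in> bord B n (brng B n (p n))"
      if "edges_below B n (p n) = {}" "d \<in> in_edges B n (brng B n (p n))" for d
      using order_total[OF v e that(2)] order_refl[OF v e] that unfolding edges_below_def by blast
    moreover have "edges_below B n (p n) = {}" if "min_edge B n (p n)"
      using that order_antisym[OF v] unfolding min_edge_def edges_below_def by blast
    ultimately show ?thesis using bpathsD(1)[OF p] unfolding min_edge_def by blast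
  qed
  finally show ?case using Suc by (auto simp: less_Suc_eq)
qed simp

text \<open>
  The blocks of indices that belong to different last edges are disjoint intervals, so the index
  determines the last edge, and the remainder is the index one level below.
\<close>
lemma path_index_inject_step:
  assumes p: "p \<in> bpaths B" and q: "q \<in> bpaths B"
    and src: "bsrc B (Suc n) (p (Suc n)) = bsrc B (Suc n) (q (Suc n))"
    and index: "path_index B (Suc n) p = path_index B (Suc n) q"
  shows "p n = q n \<and> path_index B n p = path_index B n q"
proof -
  have less: "path_index B (Suc n) p < path_index B (Suc n) q"
    if p: "p \<in> bpaths B" and q: "q \<in> bpaths B" and ne: "p n \<noteq> q n"
      and v: "brng B n (q n) = brng B n (p n)" 
      and le: "(p n, q n) \<in> bord B n (brng B n (p n))" for p q
  proof -
    have "insert (p n) (edges_below B n (p n)) \<subseteq> edges_below B n (q n)"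
      using bpathsD(4,5)[OF p, of n] ne le v order_trans[of "brng B n (p n)" n]
        order_antisym[of "brng B n (p n)" n] unfolding edges_below_def by auto
    then have "(\<Sum>d\<in>insert (p n) (edges_below B n (p n)). path_count B n (bsrc B n d))
        \<le> (\<Sum>d\<in>edges_below B n (q n). path_count B n (bsrc B n d))"
      by (intro sum_mono2 finite_edges_below) auto
    then show ?thesis using path_index_less[OF p, of n]
      by (simp add: finite_edges_below not_below_self)
  qed
  have v: "brng B n (p n) = brng B n (q n)"
    using src bpathsD(2)[OF p] bpathsD(2)[OF q] by simp
  have "p n = q n"
  proof (rule ccontr)
    assume ne: "p n \<noteq> q n"
    have "q n \<in> in_edges B n (brng B n (p n))" using bpathsD(5)[OF q, of n] by (simp add: v)
    then consider "(p n, q n) \<in> bord B n (brng B n (p n))" | "(q n, p n) \<in> bord B n (brng B n (p n))"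
      using order_total[OF bpathsD(4)[OF p] bpathsD(5)[OF p]] by blast
    then show False
    proof cases
      case 1
      then show False using less[OF p q ne v[symmetric]] index by simp
    next
      case 2
      then show False using less[OF q p ne[symmetric] v] index by (simp add: v)
    qed
  qed
  then show ?thesis using index by simp
qed

lemma first_not_max:
  assumes "\<not> (\<forall>i<n. max_edge B i (p i))"
  obtains m where "m < n" "\<not> max_edge B m (p m)" "\<forall>i<m. max_edge B i (p i)"
proof -
  obtain i where i: "i < n" "\<not> max_edge B i (p i)" using assms by blast
  then obtain m where m: "\<not> max_edge B m (p m)" "\<forall>i<m. max_edge B i (p i)"
    using exists_least_iff[of "\<lambda>i. \<not> max_edge B i (p i)"] by auto
  have "m \<le> i" using i(2) m(2) by (meson not_le)
  then show thesis using i(1) by (intro that[OF _ m]) simp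
qed

text \<open>
  The Vershik map carries like an odometer. At the first edge that is not maximal, at level \<open>m\<close>, all paths
  to the source of \<open>p m\<close> have been exhausted, and passing to the successor edge with index 0 below
  adds exactly one. Edges above \<open>m\<close> contribute the same amount before and after.
\<close>
lemma path_index_vershik_map:
  assumes p: "p \<in> bpaths B" and "\<not> (\<forall>i<n. max_edge B i (p i))"
  shows "path_index B n (vershik_map B p) = Suc (path_index B n p)"
    "bsrc B n (vershik_map B p n) = bsrc B n (p n)"
proof -
  let ?q = "vershik_map B p"
  obtain m where m: "m < n" "\<not> max_edge B m (p m)" "\<forall>i<m. max_edge B i (p i)"
    by (rule first_not_max[OF assms(2)])
  note q = vershik_map_not_max[OF p m(2,3)]
  have "Suc m \<le> n" using m(1) by simp
  then show "path_index B n ?q = Suc (path_index B n p)"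
  proof (induction rule: dec_induct)
    case base
    have "path_index B (Suc m) ?q =
        (\<Sum>d\<in>insert (p m) (edges_below B m (p m)). path_count B m (bsrc B m d))"
      using path_index_0_iff[OF q(1), of m] q(2) edges_below_succ[OF bpathsD(1)[OF p] q(3)] by simp
    then show ?case
      using path_index_max[OF p m(3)] by (simp add: finite_edges_below not_below_self)
  next
    case (step k)
    then show ?case using q(4) by simp
  qed
  have "brng B m (?q m) = brng B m (p m)"
    using q(3) by (simp add: succ_edge_iff in_edges_def)
  then show "bsrc B n (?q n) = bsrc B n (p n)"
    using \<open>Suc m \<le> n\<close> q(4) bpathsD(2)[OF p, of m] bpathsD(2)[OF q(1), of m]
    by (cases "n = Suc m") auto
qed

lemma path_index_vershik_map_max:
  assumes p: "p \<in> bpaths B" and max: "\<forall>i<n. max_edge B i (p i)" and "essentially_simple B"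
  shows "path_index B n (vershik_map B p) = 0"
proof (cases "max_path B p")
  case True
  then have "min_path B (vershik_map B p)"
    using assms(3) theI'[of "min_path B"] by (simp add: vershik_map_def essentially_simple_def)
  then show ?thesis using path_index_0_iff by (simp add: min_path_def)
next
  case False
  then obtain k where "\<not> max_edge B k (p k)" using p by (auto simp: max_path_def)
  then obtain m where m: "\<not> max_edge B m (p m)" "\<forall>i<m. max_edge B i (p i)"
    using first_not_max[of "Suc k" p] by blast
  then have "n \<le> m" using max by (meson not_le)
  then show ?thesis
    using vershik_map_not_max[OF p m] path_index_0_iff[of "vershik_map B p" n] by simp
qed

end

text \<open>
  Separation of points comes from \<open>path_index_inject_step\<close>, applied at all levels, and the base points
  are the minimal paths, of which there is one by essential simplicity.
\<close>
lemma bratteli_tower_system: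
  fixes B :: "(nat, 'e) ordered_bratteli"
  assumes B: "ordered_bratteli_diagram B" and simple: "essentially_simple B"
    and bij: "bij_betw (vershik_map B) (bpaths B) (bpaths B)"
  shows "tower_system (bpath_topology B) (vershik_map B) (\<lambda>n p. bsrc B n (p n)) (path_index B) (path_count B)"
proof -
  interpret ordered_diagram B using B by unfold_locales
  show ?thesis
  proof
    show "compact_space (bpath_topology B)"
      unfolding bpath_topology_eq
      by (rule compact_seq_space[OF finite_edges, where P = "\<lambda>n d e. d \<in> bE B n \<and> brng B n d = bsrc B (Suc n) e"])
    show "bij_betw (vershik_map B) (topspace (bpath_topology B)) (topspace (bpath_topology B))"
      using bij by (simp only: topspace_bpath_topology)
    obtain p0 where "min_path B p0" using simple by (auto simp: essentially_simple_def)
    then show "topspace (bpath_topology B) \<noteq> {}"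
      unfolding topspace_bpath_topology by (auto simp: min_path_def)
    fix n
    have "(\<lambda>p. bsrc B n (p n)) ` bpaths B \<subseteq> bV B n" using bpathsD(3) by blast
    then show "finite ((\<lambda>p. bsrc B n (p n)) ` topspace (bpath_topology B))"
      unfolding topspace_bpath_topology using finite_vertices by (rule finite_subset)
    show "openin (bpath_topology B)
        {p \<in> topspace (bpath_topology B). bsrc B n (p n) = i \<and> path_index B n p = k}" for i k
    proof (rule openin_seq_space_prefix[OF bpath_topology_eq, where N = "Suc n"])
      fix p q :: "nat \<Rightarrow> 'e" assume eq: "\<forall>i<Suc n. p i = q i" and "bsrc B n (p n) = i \<and> path_index B n p = k"
      have "path_index B m p = path_index B m q" if "m \<le> n" for m
        using that eq by (induction m) auto
      then show "bsrc B n (q n) = i \<and> path_index B n q = k"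
        using \<open>bsrc B n (p n) = i \<and> path_index B n p = k\<close> eq by simp
    qed
    fix p assume "p \<in> topspace (bpath_topology B)"
    then have p: "p \<in> bpaths B" by (simp only: topspace_bpath_topology)
    show "path_index B n p < path_count B n (bsrc B n (p n))" by (rule path_index_less[OF p])
    show "bsrc B n (vershik_map B p n) = bsrc B n (p n) \<and> path_index B n (vershik_map B p) = Suc (path_index B n p)"
      if "Suc (path_index B n p) < path_count B n (bsrc B n (p n))"
      using path_index_vershik_map[OF p, of n] path_index_max[OF p, of n] that by (metis less_irrefl)
    show "path_index B n (vershik_map B p) = 0"
      if top: "Suc (path_index B n p) = path_count B n (bsrc B n (p n))"
    proof (cases "\<forall>i<n. max_edge B i (p i)")
      case True
      then show ?thesis by (rule path_index_vershik_map_max[OF p _ simple])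
    next
      case False
      have "vershik_map B p \<in> bpaths B" using bij p by (auto simp: bij_betw_def)
      then show ?thesis
        using path_index_less[of "vershik_map B p" n] path_index_vershik_map[OF p False] top by simp
    qed
    show "path_index B n p = 0" if "path_index B (Suc n) p = 0" using that by simp
    show "path_index B 0 p = 0" by simp
    fix q assume "q \<in> topspace (bpath_topology B)"
    then have q: "q \<in> bpaths B" by (simp only: topspace_bpath_topology)
    show "bsrc B n (p n) = bsrc B n (q n) \<and> path_index B n p = path_index B n q"
      if "bsrc B (Suc n) (p (Suc n)) = bsrc B (Suc n) (q (Suc n))"
        "path_index B (Suc n) p = path_index B (Suc n) q"
      using path_index_inject_step[OF p q that] by simp
    obtain v where "bV B 0 = {v}"
      using B by (auto simp: ordered_bratteli_diagram_def bratteli_diagram_def)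
    then show "bsrc B 0 (p 0) = bsrc B 0 (q 0)" using bpathsD(3)[OF p, of 0] bpathsD(3)[OF q, of 0] by simp
    show "p = q" if "\<And>n. bsrc B n (p n) = bsrc B n (q n) \<and> path_index B n p = path_index B n q"
      using path_index_inject_step[OF p q] that by blast
    show "p = q" if "\<And>n. path_index B n p = 0" "\<And>n. path_index B n q = 0"
    proof -
      have "min_path B p" "min_path B q"
        using that path_index_0_iff[OF p] path_index_0_iff[OF q] p q unfolding min_path_def by blast+
      then show ?thesis using simple unfolding essentially_simple_def by metis
    qed
  qed
qed

section \<open>Comparison of the two ranks\<close>

lemma BV_rank_le_KR_rank:
  fixes G :: "nat \<Rightarrow> 'v::countable pair_pre_digraph"
  assumes f: "bij_betw f (topspace X) (topspace X)"
    and KR: "KR_covering G \<phi> v0 r"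
    and conj: "top_conjugate X f (invlim_topology G \<phi>) (invlim_map G \<phi>)"
  shows "top_rank_BV X f \<le> liminf (\<lambda>n. enat (r n))"
proof -
  interpret KR_covering_system G \<phi> v0 r
    using KR top_conjugate_bij[OF f conj] by unfold_locales
  interpret T: tower_system Y g tower position "\<lambda>n. height" by (rule tower_system)
  have "bratteli_rank T.diagram \<le> liminf (\<lambda>n. enat (r n))"
    unfolding bratteli_rank_def using towers_le(1)
    by (intro Liminf_mono always_eventually) (simp add: T.vertices)
  moreover have "top_rank_BV X f \<le> bratteli_rank T.diagram"
    unfolding top_rank_BV_def
    using T.diagram_ordered T.diagram_essentially_simple top_conjugate_trans[OF conj T.diagram_conjugate]
    by (intro Inf_lower) blast
  ultimately show ?thesis by order
qed

lemma frequently_le_liminf: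
  assumes "liminf (\<lambda>n. enat (a n)) = enat K"
  shows "\<exists>n>m. a n \<le> K"
proof (rule ccontr)
  assume "\<not> ?thesis"
  then have "eventually (\<lambda>n. enat (Suc K) \<le> enat (a n)) sequentially"
    by (intro eventually_sequentiallyI[of "Suc m"]) (auto simp: not_le Suc_le_eq)
  then have "enat (Suc K) \<le> liminf (\<lambda>n. enat (a n))" by (rule Liminf_bounded)
  then show False using assms by simp
qed

text \<open>
  Only a finite rank \<open>K\<close> needs an argument. Then infinitely many levels have at most \<open>K\<close> vertices,
  and the diagram is telescoped to such levels; level 0 is kept, as the first graph must be a
  single loop.
\<close>
lemma KR_rank_le_BV_rank:
  fixes B :: "(nat, 'e) ordered_bratteli"
  assumes f: "bij_betw f (topspace X) (topspace X)"
    and B: "ordered_bratteli_diagram B" "essentially_simple B"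
    and conj: "top_conjugate X f (bpath_topology B) (vershik_map B)"
  shows "top_rank_KR X f \<le> bratteli_rank B"
proof (cases "bratteli_rank B")
  case (enat K)
  interpret ordered_diagram B using B(1) by unfold_locales
  interpret T: tower_system "bpath_topology B" "vershik_map B" "\<lambda>n p. bsrc B n (p n)"
      "path_index B" "path_count B"
    using bratteli_tower_system[OF B] top_conjugate_bij[OF f conj] by (simp add: topspace_bpath_topology)
  have "\<exists>n>m. card (bV B n) \<le> K" for m
    using frequently_le_liminf[of "\<lambda>n. card (bV B n)" K m] enat by (simp add: bratteli_rank_def)
  then obtain s where s: "\<And>n. card (bV B (s (Suc n))) \<le> K"
    "proper_tower_system (bpath_topology B) (vershik_map B) (\<lambda>n p. bsrc B (s n) (p (s n)))
      (\<lambda>n. path_index B (s n)) (\<lambda>n. path_count B (s n))"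
    by (rule T.proper_subsequence[of "\<lambda>n. card (bV B n) \<le> K"]) blast+
  interpret P: proper_tower_system "bpath_topology B" "vershik_map B" "\<lambda>n p. bsrc B (s n) (p (s n))"
      "\<lambda>n. path_index B (s n)" "\<lambda>n. path_count B (s n)" by (rule s(2))
  define r where "r n = card (P.tower_circuit n ` (\<lambda>p. bsrc B (s n) (p (s n))) ` topspace (bpath_topology B))" for n
  have "r (Suc n) \<le> K" for n
  proof -
    have "r (Suc n) \<le> card ((\<lambda>p. bsrc B (s (Suc n)) (p (s (Suc n)))) ` topspace (bpath_topology B))"
      unfolding r_def by (rule card_image_le[OF P.finite_towers])
    also have "\<dots> \<le> card (bV B (s (Suc n)))"
      using bpathsD(3) by (intro card_mono finite_vertices) (auto simp: topspace_bpath_topology)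
    also note s(1)
    finally show ?thesis .
  qed
  then have "\<forall>\<^sub>F n in sequentially. enat (r n) \<le> enat K"
    by (intro eventually_sequentiallyI[of 1]) (metis One_nat_def Suc_le_D enat_ord_simps(1))
  then have "limsup (\<lambda>n. enat (r n)) \<le> enat K" by (rule Limsup_bounded)
  then have "liminf (\<lambda>n. enat (r n)) \<le> enat K"
    using Liminf_le_Limsup[of sequentially "\<lambda>n. enat (r n)"] by (simp add: order_trans)
  moreover have "top_rank_KR X f \<le> liminf (\<lambda>n. enat (r n))"
    unfolding top_rank_KR_def
    using P.KR_covering_graph[folded r_def] top_conjugate_trans[OF conj P.graph_conjugate]
    by (intro Inf_lower) blast
  ultimately show ?thesis using enat by simp
qed simp

theorem theorem3p25:
  fixes X :: "'a topology" and f :: "'a \<Rightarrow> 'a"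
  assumes "zero_dim_system X f"
    and "essentially_minimal X f"
  shows "top_rank_BV X f = top_rank_KR X f"
proof (rule antisym)
  have f: "bij_betw f (topspace X) (topspace X)"
    using assms(1) unfolding zero_dim_system_def by (blast intro: homeomorphic_map_bij)
  show "top_rank_BV X f \<le> top_rank_KR X f"
    unfolding top_rank_KR_def by (rule Inf_greatest) (use BV_rank_le_KR_rank[OF f] in blast)
  show "top_rank_KR X f \<le> top_rank_BV X f"
    unfolding top_rank_BV_def by (rule Inf_greatest) (use KR_rank_le_BV_rank[OF f] in blast)
qed

end
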